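(* Let $A\in L^1_{\mathrm{loc}}(\mathbb{R})^{d\times d}$ be such that the propagator of $y'=A(x)y$ is exponentially bounded on $\mathbb{R}$ and such that $y'=A(x)y$ has an exponential dichotomy $Q$ on $\mathbb{R}$. Assume $Q=Q_1+Q_2$, where $Q_1,Q_2$ are projections uniformly conjugated by $\Phi$ on $\mathbb{R}$ with $$\varkappa'(Q_1)\le\varkappa(Q_1)<\varkappa'(Q_2)\le\varkappa(Q_2)<0<\varkappa'(I_d-Q)\le\varkappa(I_d-Q).$$ Let $R\in L^1_{\mathrm{loc}}(\mathbb{R})^{d\times d}$ satisfy $\|R\|_{\mathbb{C}^{d\times d}}\in L^1(\mathbb{R}_+;e^{\beta x}dx)$ for some $\beta>\max_{j=1,2}\{\lambda_+(Q_j)-\varkappa_+'(Q_j)\}$. Then: (i) The generalized matrix-valued Jost solution $Y_+^{(1)}$ of $y'=(A(x)+R(x))y$ associated with the projection $Q_1$ is unique. (ii) If $Y_+^{(2)}$ and $\widetilde Y_+^{(2)}$ are any two generalized matrix-valued Jost solutions associated with the projection $Q_2$, then $\operatorname{ran}\big(Y_+^{(2)}(0)-\widetilde Y_+^{(2)}(0)\big)\subseteq\operatorname{ran}(P_1)$, where $P=P_1+P_2$ is the exponential splitting on $\mathbb{R}_+$ of the dichotomy projection $P$ of the perturbed equation described in the context.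
   Context: $\mathbb{R}_+=[0,\infty)$, $\log0=-\infty$. $\Phi'=A\Phi$ a.e., $\Phi(0)=I_d$. The propagator is exponentially bounded on $\mathbb{R}$ if $\sup_{|x-x'|\le1}\|\Phi(x)\Phi(x')^{-1}\|<\infty$. A projection $Q$ in $\mathbb{C}^d$ is an exponential dichotomy on $\mathbb{R}$ if there are constants $\varkappa,\varkappa'>0$, $C,C'\ge1$ with $\|\Phi(x)Q\Phi(x')^{-1}\|\le Ce^{-\varkappa(x-x')}$ for $x\ge x'$ and $\|\Phi(x)(I_d-Q)\Phi(x')^{-1}\|\le C'e^{\varkappa'(x-x')}$ for $x\le x'$. A projection $P$ is uniformly conjugated by $\Phi$ on $J\subseteq\mathbb{R}$ if $\sup_{x\in J}\|\Phi(x)P\Phi(x)^{-1}\|<\infty$. For such $P$ with $J=\mathbb{R}$, $\varkappa(P)$ (resp. $\varkappa'(P)$) is the infimum (resp. supremum) of all $\varkappa\in\mathbb{R}$ for which there is a constant $C(\varkappa)$ with $\|\Phi(x)P\Phi(x')^{-1}\|\le C(\varkappa)e^{\varkappa(x-x')}$ for all $x\ge x'$ (resp. $x\le x'$), $x,x'\in\mathbb{R}$; $\varkappa_+(P)$, $\varkappa_+'(P)$ are defined in the same way with $x,x'\in\mathbb{R}_+$. $\lambda_+(P)=\limsup_{x\to\infty}x^{-1}\log\|\Phi(x)P\|$. A generalized matrix-valued Jost solution associated with $Q_j$ ($j=1,2$) is a $d\times d$ matrix-valued solution $Y_+^{(j)}$ of $Y'=(A+R)Y$ on $\mathbb{R}_+$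 with $\limsup_{x\to\infty}x^{-1}\log\|Y_+^{(j)}(x)-\Phi(x)Q_j\|<\varkappa_+'(Q_j)$ and $Y_+^{(j)}(0)=Y_+^{(j)}(0)Q_j$. Splitting for the perturbed equation: since $\|R\|\in L^1(\mathbb{R}_+)$, the perturbed equation $y'=(A+R)y$ has on $\mathbb{R}_+$ mutually disjoint projections $P_1,P_2,I_d-P$ with $P=P_1+P_2$, uniformly conjugated on $\mathbb{R}_+$ by its fundamental matrix solution, with ranks equal to those of $Q_1,Q_2,I_d-Q$, and with Bohl segments on $\mathbb{R}_+$ (computed for the perturbed equation) $[\varkappa_+'(P_j),\varkappa_+(P_j)]=[\varkappa_+'(Q_j),\varkappa_+(Q_j)]$, $j=1,2$, while $\varkappa_+'(I_d-P)>0$. The projection $P_1$ is not unique, but $\operatorname{ran}(P_1)$ is: it consists exactly of $0$ and those $y_0\in\mathbb{C}^d$ for which the solution of $y'=(A+R)y$, $y(0)=y_0$, satisfies $\limsup_{x\to\infty}x^{-1}\log\|y(x)\|\le\varkappa_+(P_1)$. *)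

theory Defs
  imports "HOL-Analysis.Analysis"
begin

text \<open>
  \<open>d \<times> d\<close> complex matrices are elements of \<open>complex ^ 'n ^ 'n\<close> with \<open>d = CARD('n)\<close>; \<open>norm\<close> is the
  Euclidean (Frobenius) norm. Since \<open>d\<close> is fixed, all matrix norms are equivalent, and no notion below
  depends on which one is used.
\<close>

type_synonym 'n cmat = "complex ^ 'n ^ 'n"

definition loc_L1 :: "(real \<Rightarrow> 'n::finite cmat) \<Rightarrow> bool" where
  "loc_L1 A \<longleftrightarrow> (\<forall>a b. A absolutely_integrable_on {a..b})"

text \<open>
  Absolute continuity of functions on a compact interval. The elements of a division are finitely many
  nonempty compact intervals \<open>K = {Inf K..Sup K}\<close> with pairwise disjoint interiors.
\<close>

definition abs_cont_on :: "real \<Rightarrow> real \<Rightarrow> (real \<Rightarrow> 'a::real_normed_vector) \<Rightarrow> bool" where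
  "abs_cont_on a b f \<longleftrightarrow>
     (\<forall>\<epsilon>>0. \<exists>\<delta>>0. \<forall>D S. D division_of S \<longrightarrow> S \<subseteq> {a..b} \<longrightarrow> (\<Sum>K\<in>D. Sup K - Inf K) < \<delta> \<longrightarrow>
        (\<Sum>K\<in>D. norm (f (Sup K) - f (Inf K))) < \<epsilon>)"

text \<open>Caratheodory solutions: locally absolutely continuous on \<open>S\<close>, with \<open>Y' = A Y\<close> almost everywhere.\<close>

definition solves_on :: "real set \<Rightarrow> (real \<Rightarrow> 'n::finite cmat) \<Rightarrow> (real \<Rightarrow> 'n cmat) \<Rightarrow> bool" where
  "solves_on S A Y \<longleftrightarrow>
     (\<forall>a b. {a..b} \<subseteq> S \<longrightarrow> abs_cont_on a b Y) \<and>
     (AE x in lebesgue. x \<in> S \<longrightarrow> (Y has_vector_derivative A x ** Y x) (at x within S))"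

definition fundamental_on :: "real set \<Rightarrow> (real \<Rightarrow> 'n::finite cmat) \<Rightarrow> (real \<Rightarrow> 'n cmat) \<Rightarrow> bool" where
  "fundamental_on S A \<Phi> \<longleftrightarrow> solves_on S A \<Phi> \<and> \<Phi> 0 = mat 1"

definition propagator_exp_bounded :: "(real \<Rightarrow> 'n::finite cmat) \<Rightarrow> bool" where
  "propagator_exp_bounded \<Phi> \<longleftrightarrow>
     (\<exists>C. \<forall>x x'. \<bar>x - x'\<bar> \<le> 1 \<longrightarrow> norm (\<Phi> x ** matrix_inv (\<Phi> x')) \<le> C)"

definition projection :: "'n::finite cmat \<Rightarrow> bool" where
  "projection P \<longleftrightarrow> P ** P = P"

definition exp_dichotomy :: "(real \<Rightarrow> 'n::finite cmat) \<Rightarrow> 'n cmat \<Rightarrow> bool" where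
  "exp_dichotomy \<Phi> Q \<longleftrightarrow> projection Q \<and>
     (\<exists>\<kappa> \<kappa>' C C'. \<kappa> > 0 \<and> \<kappa>' > 0 \<and> C \<ge> 1 \<and> C' \<ge> 1 \<and>
        (\<forall>x x'. x \<ge> x' \<longrightarrow>
           norm (\<Phi> x ** Q ** matrix_inv (\<Phi> x')) \<le> C * exp (- \<kappa> * (x - x'))) \<and>
        (\<forall>x x'. x \<le> x' \<longrightarrow>
           norm (\<Phi> x ** (mat 1 - Q) ** matrix_inv (\<Phi> x')) \<le> C' * exp (\<kappa>' * (x - x'))))"

definition unif_conjugated :: "real set \<Rightarrow> (real \<Rightarrow> 'n::finite cmat) \<Rightarrow> 'n cmat \<Rightarrow> bool" where
  "unif_conjugated J \<Phi> P \<longleftrightarrow> projection P \<and>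
     (\<exists>C. \<forall>x\<in>J. norm (\<Phi> x ** P ** matrix_inv (\<Phi> x)) \<le> C)"

text \<open>
  Upper and lower Bohl exponents, with values in \<open>ereal\<close> so that the infimum and supremum of an
  empty or unbounded set of reals have their usual meaning.
\<close>

definition bohl_upper :: "real set \<Rightarrow> (real \<Rightarrow> 'n::finite cmat) \<Rightarrow> 'n cmat \<Rightarrow> ereal" where
  "bohl_upper J \<Phi> P = Inf (ereal ` {\<kappa>. \<exists>C. \<forall>x\<in>J. \<forall>x'\<in>J. x \<ge> x' \<longrightarrow>
     norm (\<Phi> x ** P ** matrix_inv (\<Phi> x')) \<le> C * exp (\<kappa> * (x - x'))})"

definition bohl_lower :: "real set \<Rightarrow> (real \<Rightarrow> 'n::finite cmat) \<Rightarrow> 'n cmat \<Rightarrow> ereal" where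
  "bohl_lower J \<Phi> P = Sup (ereal ` {\<kappa>. \<exists>C. \<forall>x\<in>J. \<forall>x'\<in>J. x \<le> x' \<longrightarrow>
     norm (\<Phi> x ** P ** matrix_inv (\<Phi> x')) \<le> C * exp (\<kappa> * (x - x'))})"

definition elog :: "real \<Rightarrow> ereal" where
  "elog r = (if r = 0 then -\<infinity> else ereal (ln r))"

definition lyap_plus :: "(real \<Rightarrow> 'n::finite cmat) \<Rightarrow> ereal" where
  "lyap_plus Y = Limsup at_top (\<lambda>x::real. ereal (inverse x) * elog (norm (Y x)))"

definition lambda_plus :: "(real \<Rightarrow> 'n::finite cmat) \<Rightarrow> 'n cmat \<Rightarrow> ereal" where
  "lambda_plus \<Phi> P = lyap_plus (\<lambda>x. \<Phi> x ** P)"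

text \<open>
  \<open>\<Phi>\<close> is the fundamental matrix of the unperturbed equation with coefficient \<open>A\<close>.
  Only the values of \<open>Y\<close> on \<open>{0..}\<close> are relevant.
\<close>

definition jost_solution ::
  "(real \<Rightarrow> 'n::finite cmat) \<Rightarrow> (real \<Rightarrow> 'n cmat) \<Rightarrow> (real \<Rightarrow> 'n cmat) \<Rightarrow> 'n cmat
     \<Rightarrow> (real \<Rightarrow> 'n cmat) \<Rightarrow> bool" where
  "jost_solution A R \<Phi> Q Y \<longleftrightarrow>
     solves_on {0..} (\<lambda>x. A x + R x) Y \<and>
     lyap_plus (\<lambda>x. Y x - \<Phi> x ** Q) < bohl_lower {0..} \<Phi> Q \<and>
     Y 0 = Y 0 ** Q"

text \<open>
  \<open>P1, P2, mat 1 - (P1 + P2)\<close> is an exponential splitting on the half line for the perturbed equation,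
  whose fundamental matrix is \<open>\<Psi>\<close>, corresponding to the splitting \<open>Q1, Q2, mat 1 - (Q1 + Q2)\<close> of the
  unperturbed equation, whose fundamental matrix is \<open>\<Phi>\<close>.
\<close>

definition perturbed_splitting ::
  "(real \<Rightarrow> 'n::finite cmat) \<Rightarrow> 'n cmat \<Rightarrow> 'n cmat \<Rightarrow> (real \<Rightarrow> 'n cmat) \<Rightarrow> 'n cmat \<Rightarrow> 'n cmat \<Rightarrow> bool"
  where
  "perturbed_splitting \<Phi> Q1 Q2 \<Psi> P1 P2 \<longleftrightarrow>
     (let P = P1 + P2; Q = Q1 + Q2; P3 = mat 1 - P in
        unif_conjugated {0..} \<Psi> P1 \<and> unif_conjugated {0..} \<Psi> P2 \<and> unif_conjugated {0..} \<Psi> P3 \<and>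
        P1 ** P2 = 0 \<and> P2 ** P1 = 0 \<and>
        P1 ** P3 = 0 \<and> P3 ** P1 = 0 \<and>
        P2 ** P3 = 0 \<and> P3 ** P2 = 0 \<and>
        rank P1 = rank Q1 \<and> rank P2 = rank Q2 \<and> rank P3 = rank (mat 1 - Q) \<and>
        bohl_lower {0..} \<Psi> P1 = bohl_lower {0..} \<Phi> Q1 \<and>
        bohl_upper {0..} \<Psi> P1 = bohl_upper {0..} \<Phi> Q1 \<and>
        bohl_lower {0..} \<Psi> P2 = bohl_lower {0..} \<Phi> Q2 \<and>
        bohl_upper {0..} \<Psi> P2 = bohl_upper {0..} \<Phi> Q2 \<and>
        bohl_lower {0..} \<Psi> P3 > 0)"

definition mat_range :: "'n::finite cmat \<Rightarrow> (complex ^ 'n) set" where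
  "mat_range M = range (\<lambda>v. M *v v)"

end

theory Submission
  imports Defs
begin

text \<open>
  The difference \<open>U\<close> of two Jost solutions associated with \<open>Q\<^sub>j\<close> solves the perturbed equation and grows
  at most like \<open>e\<^bsup>\<mu>x\<^esup>\<close> for some \<open>\<mu>\<close> below the lower Bohl exponent of \<open>Q\<^sub>j\<close>.

  For \<open>j = 1\<close> choose \<open>\<kappa>\<close> between \<open>\<mu>\<close> and that exponent. All three Bohl segments lie above \<open>\<kappa>\<close>, so
  \<open>\<Phi>(x) \<Phi>(x')\<^bsup>-1\<^esup>\<close> is \<open>O(e\<^bsup>\<kappa>(x - x')\<^esup>)\<close> for \<open>x \<le> x'\<close>, and \<open>U\<close> satisfies a homogeneous Volterra equation from
  infinity with kernel \<open>\<Phi>(x) \<Phi>(s)\<^bsup>-1\<^esup> R(s)\<close>, a contraction near infinity because \<open>\<parallel>R\<parallel>\<close> is integrable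
  (\<open>\<beta> \<ge> 0\<close>, as a Lyapunov exponent is at least the lower Bohl exponent). Hence \<open>U\<close> vanishes near
  infinity, and by backward uniqueness everywhere.

  For \<open>j = 2\<close>, \<open>U = \<Psi> U(0)\<close>, and for \<open>P = P\<^sub>2\<close> and \<open>P = I - P\<^sub>1 - P\<^sub>2\<close> the lower Bohl exponent exceeds \<open>\<mu>\<close>;
  thus \<open>P U(0) = \<Psi>(0) P \<Psi>(x)\<^bsup>-1\<^esup> U(x)\<close> tends to \<open>0\<close>, which leaves \<open>U(0) = P\<^sub>1 U(0)\<close>.
\<close>

section \<open>Absolutely continuous functions\<close>

lemma abs_cont_onD:
  assumes "abs_cont_on a b f" "\<epsilon> > 0"
  obtains \<delta> where "\<delta> > 0"
    "\<And>D S. D division_of S \<Longrightarrow> S \<subseteq> {a..b} \<Longrightarrow> (\<Sum>K\<in>D. Sup K - Inf K) < \<delta> \<Longrightarrow>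
        (\<Sum>K\<in>D. norm (f (Sup K) - f (Inf K))) < \<epsilon>"
  using assms unfolding abs_cont_on_def by blast

text \<open>Two pairs of \<open>p\<close> with the same interval have disjoint interiors, so that
  interval is a single point, where \<open>h\<close> vanishes; forgetting the tags therefore loses
  no term. This links tagged partitions, used by the gauge integral, to the untagged divisions of
  \<open>abs_cont_on\<close>.\<close>

lemma sum_tagged_partial_division:
  fixes h :: "real set \<Rightarrow> 'a::comm_monoid_add"
  assumes "p tagged_partial_division_of S" "\<And>u. h {u} = 0"
  shows "(\<Sum>(x,K)\<in>p. h K) = (\<Sum>K\<in>snd ` p. h K)"
proof -
  \<comment> \<open>The reindexing rule also asks for the value 0 on empty boxes, about which
    \<open>h\<close> is unspecified. Intervals of \<open>p\<close> contain their tags, so they are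
    nonempty and the change is harmless.\<close>
  let ?h = "\<lambda>K. if K = {} then 0 else h K"
  have ne: "K \<noteq> {}" if xK: "(x,K) \<in> p" for x K
    using assms(1) xK unfolding tagged_partial_division_of_def by blast
  have "(\<Sum>(x,K)\<in>p. ?h K) = (\<Sum>K\<in>snd ` p. ?h K)"
  proof (rule sum.over_tagged_division_lemma[OF tagged_partial_division_of_Union_self[OF assms(1)]])
    fix u v :: real
    assume "box u v = {}"
    then show "?h (cbox u v) = 0"
      using assms(2) by (cases "u = v") (auto simp: box_eq_empty)
  qed
  moreover have "(\<Sum>(x,K)\<in>p. ?h K) = (\<Sum>(x,K)\<in>p. h K)"
    by (rule sum.cong) (use ne in auto)
  moreover have "(\<Sum>K\<in>snd ` p. ?h K) = (\<Sum>K\<in>snd ` p. h K)"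
    by (rule sum.cong) (use ne in auto)
  ultimately show ?thesis by simp
qed

lemma abs_cont_continuous_on:
  fixes f :: "real \<Rightarrow> 'a::real_normed_vector"
  assumes "abs_cont_on a b f"
  shows "continuous_on {a..b} f"
proof -
  have "\<exists>d>0. \<forall>y\<in>{a..b}. dist y x < d \<longrightarrow> dist (f y) (f x) < e" if "x \<in> {a..b}" "e > 0" for x e
  proof -
    obtain d where d: "d > 0" "\<And>D S. D division_of S \<Longrightarrow> S \<subseteq> {a..b} \<Longrightarrow> (\<Sum>K\<in>D. Sup K - Inf K) < d \<Longrightarrow>
        (\<Sum>K\<in>D. norm (f (Sup K) - f (Inf K))) < e"
      by (rule abs_cont_onD[OF assms \<open>e > 0\<close>]) blast
    have *: "norm (f v - f u) < e" if "u \<in> {a..b}" "v \<in> {a..b}" "u \<le> v" "v - u < d" for u v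
    proof -
      \<comment> \<open>A division with one element turns absolute continuity into a bound for a
        single increment.\<close>
      have "{{u..v}} division_of {u..v}"
        using that by (metis box_real(2) division_of_self box_ne_empty(1) atLeastatMost_empty_iff2 not_le)
      from d(2)[OF this] that show ?thesis by auto
    qed
    show ?thesis
    proof (intro exI conjI ballI impI)
      fix y assume "y \<in> {a..b}" "dist y x < d"
      then show "dist (f y) (f x) < e"
        using *[of x y] *[of y x] that
        by (cases "x \<le> y") (auto simp: dist_norm norm_minus_commute)
    qed (rule d)
  qed
  then show ?thesis unfolding continuous_on_iff by blast
qed

text \<open>
  The straddle argument for the Henstock--Kurzweil integral: tags in the exceptional null set are
  confined to an open set of small measure, where absolute continuity controls the increments.
\<close>

theorem abs_cont_has_integral:
  fixes f :: "real \<Rightarrow> 'a::real_normed_vector"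
  assumes "a \<le> b" and ac: "abs_cont_on a b f"
    and ae: "AE x in lebesgue. x \<in> {a..b} \<longrightarrow> (f has_vector_derivative f' x) (at x within {a..b})"
  shows "(f' has_integral (f b - f a)) {a..b}"
proof -
  obtain N where N: "N \<in> null_sets lebesgue"
    and deriv: "\<And>x. x \<in> {a..b} \<Longrightarrow> x \<notin> N \<Longrightarrow> (f has_vector_derivative f' x) (at x within {a..b})"
    using ae unfolding eventually_ae_filter by auto
  \<comment> \<open>Zeroing \<open>f'\<close> on the null set leaves the integral unchanged, and a
    tag in \<open>N\<close> then contributes only the increment of \<open>f\<close>.\<close>
  define g where "g x = (if x \<in> N then 0 else f' x)" for x
  have "(g has_integral (f b - f a)) {a..b}"
    unfolding has_integral_real
  proof (intro allI impI)
    fix e :: real assume "e > 0"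
    \<comment> \<open>The slope error over tags outside \<open>N\<close> totals at most
      \<open>e1 * (b - a)\<close>; the added 1 covers \<open>a = b\<close>.\<close>
    define e1 where "e1 = e / (2 * (b - a + 1))"
    have e1: "e1 > 0" "e1 * (b - a) < e / 2"
      using \<open>e > 0\<close> \<open>a \<le> b\<close> by (auto simp: e1_def field_simps)
    have "\<exists>d>0. x \<in> {a..b} - N \<longrightarrow>
        (\<forall>y\<in>{a..b}. norm (y-x) < d \<longrightarrow> norm (f y - f x - (y-x) *\<^sub>R f' x) \<le> e1 * norm (y-x))" for x
      using deriv[unfolded has_vector_derivative_def has_derivative_within_alt, of x] e1(1)
      by (cases "x \<in> {a..b} - N") (auto intro: exI[of _ 1])
    then obtain d where d: "\<And>x. 0 < d x"
        "\<And>x y. \<lbrakk>x \<in> {a..b} - N; y \<in> {a..b}; norm (y-x) < d x\<rbrakk>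
               \<Longrightarrow> norm (f y - f x - (y-x) *\<^sub>R f' x) \<le> e1 * norm (y-x)"
      by metis
    obtain \<delta> where \<delta>: "\<delta> > 0" "\<And>D S. D division_of S \<Longrightarrow> S \<subseteq> {a..b} \<Longrightarrow> (\<Sum>K\<in>D. Sup K - Inf K) < \<delta> \<Longrightarrow>
        (\<Sum>K\<in>D. norm (f (Sup K) - f (Inf K))) < e/2"
      using \<open>e > 0\<close> by (rule_tac abs_cont_onD[OF ac, of "e/2"]) auto
    obtain U where U: "open U" "N \<subseteq> U" "U - N \<in> lmeasurable" "emeasure lebesgue (U - N) < ennreal \<delta>"
      using sets_lebesgue_outer_open[of N \<delta>] N \<delta>(1) by auto
    have U': "U \<in> lmeasurable" "measure lebesgue U < \<delta>"
    proof -
      have eq: "emeasure lebesgue (U - N) = emeasure lebesgue U"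
        using emeasure_Diff_null_set[of N lebesgue U] N U(1) by simp
      then show "U \<in> lmeasurable" using U \<delta> by (intro fmeasurableI) (auto simp: order_less_trans)
      then show "measure lebesgue U < \<delta>"
        using U(4) eq \<delta>(1) by (simp add: emeasure_eq_measure2 ennreal_less_iff)
    qed
    \<comment> \<open>Intervals tagged in \<open>N\<close> are forced into \<open>U\<close>, so
      their total length is below \<delta>.\<close>
    define \<gamma> where "\<gamma> x = (if x \<in> N then U else ball x (d x))" for x
    have "gauge \<gamma>"
      using U d(1) by (auto simp: gauge_def \<gamma>_def)
    moreover have "norm ((\<Sum>(x,K)\<in>p. measure lborel K *\<^sub>R g x) - (f b - f a)) < e"
      if p: "p tagged_division_of {a..b}" and fine: "\<gamma> fine p" for p
    proof -
      let ?T = "\<lambda>(x,K). measure lborel K *\<^sub>R g x - (f (Sup K) - f (Inf K))"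
      define p1 where "p1 = {z\<in>p. fst z \<in> N}"
      define p2 where "p2 = {z\<in>p. fst z \<notin> N}"
      have fin: "finite p" using p by blast
      have pp: "p1 \<union> p2 = p" "p1 \<inter> p2 = {}" "finite p1" "finite p2" "p1 \<subseteq> p" "p2 \<subseteq> p"
        using fin by (auto simp: p1_def p2_def)
      have K: "\<exists>u v. K = {u..v} \<and> u \<le> x \<and> x \<le> v \<and> a \<le> u \<and> v \<le> b" if xK: "(x,K) \<in> p" for x K
      proof -
        obtain u v where "K = cbox u v" using tagged_division_ofD(4)[OF p xK] by blast
        moreover have "x \<in> K" "K \<subseteq> {a..b}" using tagged_division_ofD(2,3)[OF p xK] by auto
        ultimately show ?thesis by auto
      qed
      have len: "(\<Sum>(x,K)\<in>p. Sup K - Inf K) = b - a"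
        using additive_tagged_division_1[OF \<open>a \<le> b\<close> p, of "\<lambda>x. x"] by simp
      have "(\<Sum>(x,K)\<in>p. measure lborel K *\<^sub>R g x) - (f b - f a) = sum ?T p"
        using additive_tagged_division_1[OF \<open>a \<le> b\<close> p, of f] by (simp add: sum_subtractf split_def)
      also have "\<dots> = sum ?T p1 + sum ?T p2"
        using sum.union_disjoint[OF pp(3,4,2), of ?T] pp(1) by simp
      finally have eq: "(\<Sum>(x,K)\<in>p. measure lborel K *\<^sub>R g x) - (f b - f a) = sum ?T p1 + sum ?T p2" .
      have "norm (sum ?T p2) \<le> (\<Sum>(x,K)\<in>p2. e1 * (Sup K - Inf K))"
      proof (rule sum_norm_le, safe)
        fix x K assume xK: "(x,K) \<in> p2"
        then have xKp: "(x,K) \<in> p" and xN: "x \<notin> N" by (auto simp: p2_def)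
        obtain u v where uv: "K = {u..v}" "u \<le> x" "x \<le> v" "a \<le> u" "v \<le> b" using K[OF xKp] by blast
        have sub: "K \<subseteq> ball x (d x)" using fineD[OF fine xKp] xN by (simp add: \<gamma>_def)
        have uK: "u \<in> ball x (d x)" and vK: "v \<in> ball x (d x)"
          using subsetD[OF sub, of u] subsetD[OF sub, of v] uv by auto
        have b1: "norm (f u - f x - (u-x) *\<^sub>R f' x) \<le> e1 * norm (u-x)"
          using uv uK xN by (intro d(2)) (auto simp: dist_real_def)
        have b2: "norm (f v - f x - (v-x) *\<^sub>R f' x) \<le> e1 * norm (v-x)"
          using uv vK xN by (intro d(2)) (auto simp: dist_real_def)
        \<comment> \<open>Both endpoints are compared with the tag; since it lies between them, the
          two distances add up to the length of \<open>K\<close>.\<close>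
        have "norm (?T (x,K)) = norm ((f u - f x - (u-x) *\<^sub>R f' x) - (f v - f x - (v-x) *\<^sub>R f' x))"
          using uv xN by (simp add: g_def algebra_simps)
        also have "\<dots> \<le> e1 * norm (u-x) + e1 * norm (v-x)"
          using norm_triangle_ineq4 b1 b2 by (meson add_mono order_trans)
        also have "\<dots> = e1 * (Sup K - Inf K)"
          using uv by (simp add: algebra_simps)
        finally show "norm (measure lborel K *\<^sub>R g x - (f (Sup K) - f (Inf K))) \<le> e1 * (Sup K - Inf K)" by simp
      qed
      also have "\<dots> \<le> (\<Sum>(x,K)\<in>p. e1 * (Sup K - Inf K))"
      proof (rule sum_mono2[OF fin pp(6)])
        fix z assume z: "z \<in> p - p2"
        obtain x K where xK: "z = (x,K)" by (cases z)
        then obtain u v where "K = {u..v}" "u \<le> x" "x \<le> v" using K z by blast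
        then show "0 \<le> (case z of (x,K) \<Rightarrow> e1 * (Sup K - Inf K))" using e1 xK by simp
      qed
      also have "\<dots> = e1 * (b - a)"
        unfolding len[symmetric] by (simp add: sum_distrib_left split_def)
      also have "\<dots> < e / 2" by (rule e1)
      finally have 2: "norm (sum ?T p2) < e / 2" .
      have part: "p1 tagged_partial_division_of {a..b}"
        by (rule tagged_partial_division_subset[OF _ pp(5)]) (use p in \<open>simp add: tagged_division_of_def\<close>)
      have div: "snd ` p1 division_of \<Union>(snd ` p1)"
        by (rule division_of_tagged_division[OF tagged_partial_division_of_Union_self[OF part]])
      have subU: "\<Union>(snd ` p1) \<subseteq> U"
      proof
        fix y assume "y \<in> \<Union>(snd ` p1)"
        then obtain x K where xK: "(x,K) \<in> p" "x \<in> N" "y \<in> K" by (auto simp: p1_def)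
        then show "y \<in> U" using fineD[OF fine xK(1)] by (auto simp: \<gamma>_def)
      qed
      have subab: "\<Union>(snd ` p1) \<subseteq> {a..b}"
      proof
        fix y assume "y \<in> \<Union>(snd ` p1)"
        then obtain x K where xK: "(x,K) \<in> p" "y \<in> K" using pp(5) by auto
        then show "y \<in> {a..b}" using K[OF xK(1)] by auto
      qed
      have "(\<Sum>K\<in>snd ` p1. Sup K - Inf K) = (\<Sum>K\<in>snd ` p1. measure lebesgue K)"
      proof (rule sum.cong[OF refl])
        fix k assume "k \<in> snd ` p1"
        then obtain x where "(x,k) \<in> p" using pp(5) by auto
        from K[OF this] show "Sup k - Inf k = measure lebesgue k" by auto
      qed
      also have "\<dots> = measure lebesgue (\<Union>(snd ` p1))"
        by (rule content_division[OF div])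
      also have "\<dots> \<le> measure lebesgue U"
        using lmeasurable_division[OF div] U'(1) subU by (intro measure_mono_fmeasurable) auto
      also have "\<dots> < \<delta>" by (rule U')
      finally have small: "(\<Sum>K\<in>snd ` p1. norm (f (Sup K) - f (Inf K))) < e/2"
        by (intro \<delta>(2)[OF div subab])
      have "norm (sum ?T p1) \<le> (\<Sum>(x,K)\<in>p1. norm (f (Sup K) - f (Inf K)))"
        by (rule sum_norm_le) (auto simp: p1_def g_def norm_minus_commute)
      also have "\<dots> = (\<Sum>K\<in>snd ` p1. norm (f (Sup K) - f (Inf K)))"
        by (rule sum_tagged_partial_division[OF part]) simp
      finally have 1: "norm (sum ?T p1) < e/2" using small by simp
      have "norm (sum ?T p1) + norm (sum ?T p2) < e / 2 + e / 2"
        by (rule add_strict_mono[OF 1 2])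
      then show ?thesis unfolding eq by (intro norm_triangle_lt) simp
    qed
    ultimately show "\<exists>\<gamma>. gauge \<gamma> \<and> (\<forall>p. p tagged_division_of {a..b} \<and> \<gamma> fine p \<longrightarrow>
        norm ((\<Sum>(x,K)\<in>p. measure lborel K *\<^sub>R g x) - (f b - f a)) < e)"
      by (intro exI[of _ \<gamma>] conjI allI impI) (simp_all only:)
  qed
  then show ?thesis
    by (rule has_integral_spike[of N, rotated 2]) (use N in \<open>auto simp: g_def negligible_iff_null_sets\<close>)
qed

text \<open>The quotient form lets a product be differentiated by limits alone, with one factor
  known only to be continuous, as for the inverse fundamental matrix below.\<close>

lemma has_vector_derivative_iff_quotient:
  "(f has_vector_derivative f') (at x within S) \<longleftrightarrow>
     ((\<lambda>y. (f y - f x) /\<^sub>R (y - x)) \<longlongrightarrow> f') (at x within S)"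
proof -
  have "(f has_vector_derivative f') (at x within S) \<longleftrightarrow>
     ((\<lambda>y. (1 / norm (y - x)) *\<^sub>R (f y - (f x + (y - x) *\<^sub>R f'))) \<longlongrightarrow> 0) (at x within S)"
    by (simp add: has_vector_derivative_def has_derivative_within bounded_linear_scaleR_left)
  also have "\<dots> \<longleftrightarrow> ((\<lambda>y. norm ((1 / norm (y - x)) *\<^sub>R (f y - (f x + (y - x) *\<^sub>R f')))) \<longlongrightarrow> 0) (at x within S)"
    by (rule tendsto_norm_zero_iff[symmetric])
  also have "\<dots> \<longleftrightarrow> ((\<lambda>y. norm ((f y - f x) /\<^sub>R (y - x) - f')) \<longlongrightarrow> 0) (at x within S)"
  proof (rule filterlim_cong[OF refl refl])
    have "norm ((1 / norm (y - x)) *\<^sub>R (f y - (f x + (y - x) *\<^sub>R f'))) = norm ((f y - f x) /\<^sub>R (y - x) - f')"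
      if "y \<noteq> x" for y
    proof -
      have "(1 / (y - x)) *\<^sub>R (f y - (f x + (y - x) *\<^sub>R f'))
          = (1 / (y - x)) *\<^sub>R (f y - f x) - (1 / (y - x)) *\<^sub>R ((y - x) *\<^sub>R f')"
        by (simp only: diff_diff_eq flip: scaleR_diff_right)
      also have "\<dots> = (f y - f x) /\<^sub>R (y - x) - f'"
        using that by (simp add: divide_inverse)
      finally show ?thesis
        by (metis norm_scaleR abs_divide abs_one abs_norm_cancel real_norm_def)
    qed
    then show "\<forall>\<^sub>F y in at x within S. norm ((1 / norm (y - x)) *\<^sub>R (f y - (f x + (y - x) *\<^sub>R f')))
        = norm ((f y - f x) /\<^sub>R (y - x) - f')"
      by (auto simp: eventually_at_filter)
  qed
  also have "\<dots> \<longleftrightarrow> ((\<lambda>y. (f y - f x) /\<^sub>R (y - x)) \<longlongrightarrow> f') (at x within S)"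
    by (simp only: tendsto_norm_zero_iff flip: Lim_null)
  finally show ?thesis .
qed

text \<open>Increments of \<open>f\<close> over a division are dominated termwise by those of
  \<open>g\<close> and \<open>h\<close>, so half of the tolerance goes to each. Differences,
  constant multiples and the product with an inverse matrix are all handled this way.\<close>

lemma abs_cont_on_comparison:
  fixes f :: "real \<Rightarrow> 'a::real_normed_vector" and g :: "real \<Rightarrow> 'b::real_normed_vector"
    and h :: "real \<Rightarrow> 'c::real_normed_vector"
  assumes g: "abs_cont_on a b g" and h: "abs_cont_on a b h"
    and le: "\<And>u v. u \<in> {a..b} \<Longrightarrow> v \<in> {a..b} \<Longrightarrow> norm (f v - f u) \<le> c * (norm (g v - g u) + norm (h v - h u))"
  shows "abs_cont_on a b f"
  unfolding abs_cont_on_def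
proof (intro allI impI)
  fix e :: real assume "e > 0"
  \<comment> \<open>A positive majorant of \<open>c\<close>, which may be divided by.\<close>
  define c' where "c' = \<bar>c\<bar> + 1"
  have "c' > 0" "c \<le> c'" by (auto simp: c'_def)
  then have e': "e / (2 * c') > 0" using \<open>e > 0\<close> by simp
  obtain \<delta>1 where 1: "\<delta>1 > 0" "\<And>D S. D division_of S \<Longrightarrow> S \<subseteq> {a..b} \<Longrightarrow> (\<Sum>K\<in>D. Sup K - Inf K) < \<delta>1 \<Longrightarrow>
        (\<Sum>K\<in>D. norm (g (Sup K) - g (Inf K))) < e / (2 * c')"
    by (rule abs_cont_onD[OF g e']) blast
  obtain \<delta>2 where 2: "\<delta>2 > 0" "\<And>D S. D division_of S \<Longrightarrow> S \<subseteq> {a..b} \<Longrightarrow> (\<Sum>K\<in>D. Sup K - Inf K) < \<delta>2 \<Longrightarrow>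
        (\<Sum>K\<in>D. norm (h (Sup K) - h (Inf K))) < e / (2 * c')"
    by (rule abs_cont_onD[OF h e']) blast
  show "\<exists>\<delta>>0. \<forall>D S. D division_of S \<longrightarrow> S \<subseteq> {a..b} \<longrightarrow> (\<Sum>K\<in>D. Sup K - Inf K) < \<delta> \<longrightarrow>
        (\<Sum>K\<in>D. norm (f (Sup K) - f (Inf K))) < e"
  proof (intro exI[of _ "min \<delta>1 \<delta>2"] conjI allI impI)
    fix D and S :: "real set" assume D: "D division_of S" "S \<subseteq> {a..b}" "(\<Sum>K\<in>D. Sup K - Inf K) < min \<delta>1 \<delta>2"
    have "(\<Sum>K\<in>D. norm (f (Sup K) - f (Inf K)))
        \<le> (\<Sum>K\<in>D. c' * (norm (g (Sup K) - g (Inf K)) + norm (h (Sup K) - h (Inf K))))"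
    proof (rule sum_mono)
      fix K assume "K \<in> D"
      then obtain u v where "K = cbox u v" "K \<noteq> {}" "K \<subseteq> S" using division_ofD(2-4)[OF D(1)] by metis
      moreover from this have "K \<subseteq> {a..b}" using D(2) by blast
      ultimately have uv: "Sup K \<in> {a..b}" "Inf K \<in> {a..b}" by auto
      have "norm (f (Sup K) - f (Inf K)) \<le> c * (norm (g (Sup K) - g (Inf K)) + norm (h (Sup K) - h (Inf K)))"
        by (rule le[OF uv(2,1)])
      also have "\<dots> \<le> c' * (norm (g (Sup K) - g (Inf K)) + norm (h (Sup K) - h (Inf K)))"
        using \<open>c \<le> c'\<close> by (intro mult_right_mono) auto
      finally show "norm (f (Sup K) - f (Inf K))
          \<le> c' * (norm (g (Sup K) - g (Inf K)) + norm (h (Sup K) - h (Inf K)))" .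
    qed
    also have "\<dots> = c' * ((\<Sum>K\<in>D. norm (g (Sup K) - g (Inf K))) + (\<Sum>K\<in>D. norm (h (Sup K) - h (Inf K))))"
      by (simp only: sum.distrib flip: sum_distrib_left)
    also have "\<dots> < c' * (e / (2 * c') + e / (2 * c'))"
      using 1(2)[OF D(1,2)] 2(2)[OF D(1,2)] D(3) \<open>c' > 0\<close>
      by (intro mult_strict_left_mono add_strict_mono) auto
    also have "\<dots> = e" using \<open>c' > 0\<close> by (simp add: field_simps)
    finally show "(\<Sum>K\<in>D. norm (f (Sup K) - f (Inf K))) < e" .
  qed (use 1 2 in auto)
qed

section \<open>Complex matrices\<close>

lemma norm_matrix_power2:
  fixes A :: "complex^'n::finite^'m::finite"
  shows "(norm A)\<^sup>2 = (\<Sum>i\<in>UNIV. \<Sum>j\<in>UNIV. (cmod (A $ i $ j))\<^sup>2)"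
  by (simp add: norm_vec_def L2_set_def sum_nonneg)

text \<open>Cauchy-Schwarz for each entry of the product, then summation over rows and columns: the
  Frobenius norm is submultiplicative.\<close>

lemma norm_matrix_mult_le:
  fixes A :: "complex^'n::finite^'m::finite" and B :: "complex^'p::finite^'n"
  shows "norm (A ** B) \<le> norm A * norm B"
proof (rule power2_le_imp_le)
  have "(norm (A ** B))\<^sup>2 = (\<Sum>i\<in>UNIV. \<Sum>j\<in>UNIV. (cmod (\<Sum>k\<in>UNIV. A $ i $ k * B $ k $ j))\<^sup>2)"
    by (simp add: norm_matrix_power2 matrix_matrix_mult_def)
  also have "\<dots> \<le> (\<Sum>i\<in>UNIV. \<Sum>j\<in>UNIV. (\<Sum>k\<in>UNIV. (cmod (A $ i $ k))\<^sup>2) * (\<Sum>k\<in>UNIV. (cmod (B $ k $ j))\<^sup>2))"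
  proof (intro sum_mono)
    fix i :: 'm and j :: 'p
    have "cmod (\<Sum>k\<in>UNIV. A $ i $ k * B $ k $ j) \<le> (\<Sum>k\<in>UNIV. cmod (A $ i $ k) * cmod (B $ k $ j))"
      by (rule order_trans[OF norm_sum]) (simp add: norm_mult)
    also have "\<dots> \<le> L2_set (\<lambda>k. cmod (A $ i $ k)) UNIV * L2_set (\<lambda>k. cmod (B $ k $ j)) UNIV"
      using L2_set_mult_ineq[of "\<lambda>k. cmod (A $ i $ k)" "\<lambda>k. cmod (B $ k $ j)" UNIV] by simp
    finally have "(cmod (\<Sum>k\<in>UNIV. A $ i $ k * B $ k $ j))\<^sup>2
        \<le> (L2_set (\<lambda>k. cmod (A $ i $ k)) UNIV * L2_set (\<lambda>k. cmod (B $ k $ j)) UNIV)\<^sup>2"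
      by (rule power_mono) simp
    then show "(cmod (\<Sum>k\<in>UNIV. A $ i $ k * B $ k $ j))\<^sup>2
        \<le> (\<Sum>k\<in>UNIV. (cmod (A $ i $ k))\<^sup>2) * (\<Sum>k\<in>UNIV. (cmod (B $ k $ j))\<^sup>2)"
      by (simp add: L2_set_def power_mult_distrib sum_nonneg)
  qed
  also have "\<dots> = (\<Sum>i\<in>UNIV. \<Sum>k\<in>UNIV. (cmod (A $ i $ k))\<^sup>2) * (\<Sum>j\<in>UNIV. \<Sum>k\<in>UNIV. (cmod (B $ k $ j))\<^sup>2)"
    by (rule sum_product[symmetric])
  also have "(\<Sum>j\<in>UNIV. \<Sum>k\<in>UNIV. (cmod (B $ k $ j))\<^sup>2) = (norm B)\<^sup>2"
    unfolding norm_matrix_power2 by (rule sum.swap)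
  finally show "(norm (A ** B))\<^sup>2 \<le> (norm A * norm B)\<^sup>2"
    by (simp add: norm_matrix_power2 power_mult_distrib)
qed simp

lemma bounded_bilinear_matrix_mult:
  "bounded_bilinear ((**) :: complex^'n::finite^'m::finite \<Rightarrow> complex^'p::finite^'n \<Rightarrow> complex^'p^'m)"
proof
  show "\<exists>K. \<forall>(a :: complex^'n^'m) (b :: complex^'p^'n). norm (a ** b) \<le> norm a * norm b * K"
    by (rule exI[of _ 1]) (simp add: norm_matrix_mult_le)
qed (simp_all add: vec_eq_iff matrix_matrix_mult_def sum.distrib algebra_simps scaleR_sum_right)

lemmas matrix_mult_diff_left = bounded_bilinear.diff_left[OF bounded_bilinear_matrix_mult]
lemmas matrix_mult_diff_right = bounded_bilinear.diff_right[OF bounded_bilinear_matrix_mult]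
lemmas matrix_mult_add_left = bounded_bilinear.add_left[OF bounded_bilinear_matrix_mult]
lemmas matrix_mult_add_right = bounded_bilinear.add_right[OF bounded_bilinear_matrix_mult]
lemmas matrix_mult_scaleR_left = bounded_bilinear.scaleR_left[OF bounded_bilinear_matrix_mult]
lemmas matrix_mult_scaleR_right = bounded_bilinear.scaleR_right[OF bounded_bilinear_matrix_mult]
lemmas matrix_mult_zero_left = bounded_bilinear.zero_left[OF bounded_bilinear_matrix_mult]
lemmas matrix_mult_zero_right = bounded_bilinear.zero_right[OF bounded_bilinear_matrix_mult]
lemmas bounded_linear_matrix_mult_left = bounded_bilinear.bounded_linear_left[OF bounded_bilinear_matrix_mult]
lemmas tendsto_matrix_mult = bounded_bilinear.tendsto[OF bounded_bilinear_matrix_mult]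

lemma matrix_inv_cancel:
  assumes "invertible A"
  shows "A ** matrix_inv A = mat 1" "matrix_inv A ** A = mat 1"
  using someI_ex[OF assms[unfolded invertible_def]] by (auto simp: matrix_inv_def)

section \<open>Caratheodory solutions\<close>

lemma solves_on_subset:
  assumes "solves_on S A Y" "T \<subseteq> S"
  shows "solves_on T A Y"
  using assms unfolding solves_on_def
  by (auto elim!: eventually_mono intro: has_vector_derivative_within_subset)

lemma solves_on_diff:
  assumes Y: "solves_on S A Y" and Z: "solves_on S A Z"
  shows "solves_on S A (\<lambda>x. Y x - Z x)"
  unfolding solves_on_def
proof (intro conjI allI impI)
  fix a b assume "{a..b} \<subseteq> S"
  show "abs_cont_on a b (\<lambda>x. Y x - Z x)"
  proof (rule abs_cont_on_comparison[where c = 1])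
    fix u v
    have "norm (Y v - Z v - (Y u - Z u)) = norm ((Y v - Y u) - (Z v - Z u))" by (simp add: algebra_simps)
    also have "\<dots> \<le> norm (Y v - Y u) + norm (Z v - Z u)" by (rule norm_triangle_ineq4)
    finally show "norm (Y v - Z v - (Y u - Z u)) \<le> 1 * (norm (Y v - Y u) + norm (Z v - Z u))" by simp
  qed (use Y Z \<open>{a..b} \<subseteq> S\<close> in \<open>auto simp: solves_on_def\<close>)
next
  have "AE x in lebesgue. x \<in> S \<longrightarrow> (Y has_vector_derivative A x ** Y x) (at x within S)"
    "AE x in lebesgue. x \<in> S \<longrightarrow> (Z has_vector_derivative A x ** Z x) (at x within S)"
    using Y Z by (auto simp: solves_on_def)
  then show "AE x in lebesgue. x \<in> S \<longrightarrow>
      ((\<lambda>x. Y x - Z x) has_vector_derivative A x ** (Y x - Z x)) (at x within S)"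
    by eventually_elim (simp add: has_vector_derivative_diff matrix_mult_diff_right)
qed

lemma solves_on_mult_right:
  assumes Y: "solves_on S A Y"
  shows "solves_on S A (\<lambda>x. Y x ** V)"
  unfolding solves_on_def
proof (intro conjI allI impI)
  fix a b assume "{a..b} \<subseteq> S"
  then have ac: "abs_cont_on a b Y" using Y by (auto simp: solves_on_def)
  show "abs_cont_on a b (\<lambda>x. Y x ** V)"
  proof (rule abs_cont_on_comparison[OF ac ac, where c = "norm V"])
    fix u v
    have "norm (Y v ** V - Y u ** V) \<le> norm (Y v - Y u) * norm V"
      by (metis norm_matrix_mult_le matrix_mult_diff_left)
    also have "\<dots> \<le> norm V * (norm (Y v - Y u) + norm (Y v - Y u))"
      by (simp add: mult.commute distrib_left)
    finally show "norm (Y v ** V - Y u ** V) \<le> norm V * (norm (Y v - Y u) + norm (Y v - Y u))" .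
  qed
next
  have "AE x in lebesgue. x \<in> S \<longrightarrow> (Y has_vector_derivative A x ** Y x) (at x within S)"
    using Y by (auto simp: solves_on_def)
  then show "AE x in lebesgue. x \<in> S \<longrightarrow>
      ((\<lambda>x. Y x ** V) has_vector_derivative A x ** (Y x ** V)) (at x within S)"
    by eventually_elim
      (auto simp: matrix_mul_assoc dest: bounded_linear.has_vector_derivative[OF bounded_linear_matrix_mult_left])
qed

lemma solves_on_has_integral:
  assumes "solves_on S A Y" "{a..b} \<subseteq> S" "a \<le> b"
  shows "((\<lambda>x. A x ** Y x) has_integral (Y b - Y a)) {a..b}"
proof (rule abs_cont_has_integral)
  show "AE x in lebesgue. x \<in> {a..b} \<longrightarrow> (Y has_vector_derivative A x ** Y x) (at x within {a..b})"
    using solves_on_subset[OF assms(1,2)] by (simp add: solves_on_def)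
qed (use assms in \<open>auto simp: solves_on_def\<close>)

lemma solves_on_continuous:
  assumes "solves_on S A Y" "{a..b} \<subseteq> S"
  shows "continuous_on {a..b} Y"
  using assms by (auto simp: solves_on_def intro: abs_cont_continuous_on)

section \<open>Backward uniqueness and invertibility of fundamental matrices\<close>

lemma loc_L1_norm_integrable:
  assumes "loc_L1 A"
  shows "(\<lambda>x. norm (A x)) integrable_on {a..b}"
  using assms by (auto simp: loc_L1_def absolutely_integrable_on_def)

lemma loc_L1_add: "loc_L1 A \<Longrightarrow> loc_L1 B \<Longrightarrow> loc_L1 (\<lambda>x. A x + B x)"
  unfolding loc_L1_def by (auto intro: set_integral_add(1))

lemma continuous_on_interval_max:
  fixes f :: "real \<Rightarrow> real"
  assumes "continuous_on {a..b} f" "a \<le> b"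
  obtains x where "x \<in> {a..b}" "\<And>y. y \<in> {a..b} \<Longrightarrow> f y \<le> f x"
  using continuous_attains_sup[OF compact_Icc _ assms(1)] assms(2) by auto

text \<open>At a maximum point \<open>m\<close> of the norm, integrating the equation from
  \<open>m\<close> to \<open>t\<close> bounds \<open>norm (Z m)\<close> by itself times the integral
  of \<open>norm (B x)\<close>, a factor below 1. This takes the place of a Gronwall
  estimate.\<close>

lemma solves_on_zero_step:
  assumes Z: "solves_on {s..t} B Z" and "s \<le> t" and int: "(\<lambda>x. norm (B x)) integrable_on {s..t}"
    and small: "integral {s..t} (\<lambda>x. norm (B x)) < 1" and zero: "Z t = 0"
  shows "\<forall>x\<in>{s..t}. Z x = 0"
proof -
  have "continuous_on {s..t} (\<lambda>x. norm (Z x))"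
    using solves_on_continuous[OF Z] by (intro continuous_on_norm) auto
  then obtain m where m: "m \<in> {s..t}" "\<And>y. y \<in> {s..t} \<Longrightarrow> norm (Z y) \<le> norm (Z m)"
    using continuous_on_interval_max \<open>s \<le> t\<close> by blast
  have sub: "{m..t} \<subseteq> {s..t}" using m by auto
  have int': "(\<lambda>x. norm (B x)) integrable_on {m..t}"
    using integrable_on_subinterval[OF int sub] .
  have "((\<lambda>x. B x ** Z x) has_integral (Z t - Z m)) {m..t}"
    using solves_on_has_integral[OF Z sub] m by simp
  then have BZ: "(\<lambda>x. B x ** Z x) integrable_on {m..t}" and eq: "Z t - Z m = integral {m..t} (\<lambda>x. B x ** Z x)"
    by (auto simp: has_integral_integrable_integral)
  have le: "norm (B x ** Z x) \<le> norm (B x) * norm (Z m)" if "x \<in> {m..t}" for x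
    using that sub by (intro order_trans[OF norm_matrix_mult_le] mult_left_mono m(2)) auto
  have "norm (Z t - Z m) \<le> integral {m..t} (\<lambda>x. norm (B x) * norm (Z m))"
    unfolding eq by (intro integral_norm_bound_integral BZ le integrable_on_mult_left int')
  also have "\<dots> = integral {m..t} (\<lambda>x. norm (B x)) * norm (Z m)"
    by (rule integral_mult_left)
  also have "\<dots> \<le> integral {s..t} (\<lambda>x. norm (B x)) * norm (Z m)"
    by (intro mult_right_mono integral_subset_le sub int int') auto
  finally have "norm (Z m) * (1 - integral {s..t} (\<lambda>x. norm (B x))) \<le> 0"
    using zero by (simp add: algebra_simps)
  then have "norm (Z m) \<le> 0" using small by (simp add: mult_le_0_iff)
  then show ?thesis using m(2) by (metis norm_le_zero_iff order_trans)
qed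

text \<open>Uniform continuity of the indefinite integral of the coefficient norm yields one step
  length for which the preceding lemma applies everywhere; finitely many steps back from
  \<open>t\<close> reach \<open>x\<close>.\<close>

lemma solves_on_backward_unique:
  assumes Z: "solves_on {a..t} B Z" and int: "(\<lambda>x. norm (B x)) integrable_on {a..t}"
    and zero: "Z t = 0" and x: "x \<in> {a..t}"
  shows "Z x = 0"
proof -
  define G where "G x = integral {x..t} (\<lambda>x. norm (B x))" for x
  have "continuous_on {a..t} G"
    unfolding G_def by (rule indefinite_integral_continuous_1'[OF int])
  then have "uniformly_continuous_on {a..t} G"
    by (simp add: compact_uniformly_continuous)
  then obtain \<eta> where \<eta>: "\<eta> > 0" "\<And>u v. u \<in> {a..t} \<Longrightarrow> v \<in> {a..t} \<Longrightarrow> \<bar>v - u\<bar> < \<eta> \<Longrightarrow> \<bar>G v - G u\<bar> < 1"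
    unfolding uniformly_continuous_on_def dist_real_def by (metis zero_less_one)
  \<comment> \<open>Steps of length \<eta>/2 keep the distance strictly below \<eta>.\<close>
  have *: "\<forall>y\<in>{a..t}. t - real n * (\<eta>/2) \<le> y \<longrightarrow> Z y = 0" for n
  proof (induction n)
    case 0
    then show ?case using zero by auto
  next
    case (Suc n)
    show ?case
    proof (intro ballI impI)
      fix y assume y: "y \<in> {a..t}" "t - real (Suc n) * (\<eta>/2) \<le> y"
      define u where "u = min t (y + \<eta>/2)"
      have u: "u \<in> {a..t}" "y \<le> u" "\<bar>u - y\<bar> < \<eta>" using y \<eta>(1) by (auto simp: u_def)
      have "real (Suc n) * (\<eta>/2) = real n * (\<eta>/2) + \<eta>/2" by (simp add: field_simps)
      then have "t - real n * (\<eta>/2) \<le> y + \<eta>/2" using y(2) by linarith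
      then have "t - real n * (\<eta>/2) \<le> u" using \<eta>(1) by (simp add: u_def)
      then have "Z u = 0" using Suc u by blast
      have sub: "{y..u} \<subseteq> {a..t}" using y u by auto
      have "integral {y..u} (\<lambda>x. norm (B x)) + G u = G y"
        unfolding G_def using y u int
        by (intro Henstock_Kurzweil_Integration.integral_combine) (auto intro: integrable_on_subinterval)
      then have "integral {y..u} (\<lambda>x. norm (B x)) < 1"
        using \<eta>(2)[OF y(1) u(1) u(3)] by linarith
      then show "Z y = 0"
        using solves_on_zero_step[OF solves_on_subset[OF Z sub] u(2) integrable_on_subinterval[OF int sub] _ \<open>Z u = 0\<close>] u
        by auto
    qed
  qed
  obtain n where "(t - x) / (\<eta>/2) \<le> real n" using real_arch_simple by blast
  then have "t - real n * (\<eta>/2) \<le> x" using \<eta>(1) by (simp add: field_simps)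
  then show ?thesis using * x by blast
qed

text \<open>A kernel vector of \<open>\<Phi> x\<close> starts a solution that vanishes at
  \<open>x\<close>, hence at 0 by backward uniqueness, where \<Phi> is the identity.\<close>

lemma fundamental_on_invertible:
  assumes \<Phi>: "fundamental_on {0..} B \<Phi>" and B: "loc_L1 B" and "0 \<le> x"
  shows "invertible (\<Phi> x)"
proof -
  have "v = 0" if "\<Phi> x *v v = 0" for v
  proof -
    \<comment> \<open>Solutions are matrix-valued, so the vector is repeated in every
      column.\<close>
    define V :: "complex^'a^'a" where "V = (\<chi> i j. v $ i)"
    have col: "M ** V = (\<chi> i j. (M *v v) $ i)" for M :: "complex^'a^'a"
      by (simp add: V_def vec_eq_iff matrix_matrix_mult_def matrix_vector_mult_def)
    have "solves_on {0..x} B (\<lambda>x. \<Phi> x ** V)"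
      using \<Phi> by (intro solves_on_mult_right) (auto simp: fundamental_on_def intro: solves_on_subset)
    moreover have "\<Phi> x ** V = 0" using that by (simp add: col vec_eq_iff)
    ultimately have "\<Phi> 0 ** V = 0"
      using solves_on_backward_unique[OF _ loc_L1_norm_integrable[OF B], of 0 x "\<lambda>x. \<Phi> x ** V" 0] \<open>0 \<le> x\<close> by auto
    then have "V = 0"
      using \<Phi> by (simp add: fundamental_on_def)
    then show "v = 0"
      by (simp add: V_def vec_eq_iff)
  qed
  then show ?thesis
    unfolding invertible_left_inverse matrix_left_invertible_ker by blast
qed

text \<open>The bound on the inverse makes it absolutely continuous, by comparison with \<open>\<Phi>\<close>.\<close>

lemma variation_of_constants:
  assumes \<Phi>: "solves_on {a..b} A \<Phi>" and inv: "\<And>x. x \<in> {a..b} \<Longrightarrow> invertible (\<Phi> x)"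
    and bound: "\<And>x. x \<in> {a..b} \<Longrightarrow> norm (matrix_inv (\<Phi> x)) \<le> M"
    and Y: "solves_on {a..b} (\<lambda>x. A x + R x) Y" and "a \<le> b"
  shows "((\<lambda>x. matrix_inv (\<Phi> x) ** (R x ** Y x)) has_integral
           (matrix_inv (\<Phi> b) ** Y b - matrix_inv (\<Phi> a) ** Y a)) {a..b}"
proof (rule abs_cont_has_integral[where f = "\<lambda>x. matrix_inv (\<Phi> x) ** Y x", OF \<open>a \<le> b\<close>])
  define D where "D x = matrix_inv (\<Phi> x)" for x
  define W where "W x = D x ** Y x" for x
  have D: "\<Phi> x ** D x = mat 1" "D x ** \<Phi> x = mat 1" if "x \<in> {a..b}" for x
    using matrix_inv_cancel[OF inv[OF that]] by (auto simp: D_def)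
  have "0 \<le> M" using order_trans[OF norm_ge_zero bound[of a]] \<open>a \<le> b\<close> by simp
  have contY: "continuous_on {a..b} Y" and cont\<Phi>: "continuous_on {a..b} \<Phi>"
    using Y \<Phi> solves_on_continuous by blast+
  \<comment> \<open>The resolvent-type identity: with both inverses bounded by \<open>M\<close>,
    continuity of \<Phi> passes to \<open>D\<close>.\<close>
  have D_diff: "D v - D u = D v ** ((\<Phi> u - \<Phi> v) ** D u)" if "u \<in> {a..b}" "v \<in> {a..b}" for u v
  proof -
    have "D v ** (\<Phi> u ** D u) = D v" by (simp add: D[OF that(1)])
    moreover have "D v ** (\<Phi> v ** D u) = D u" by (simp add: matrix_mul_assoc D[OF that(2)])
    ultimately show ?thesis by (simp add: matrix_mult_diff_left matrix_mult_diff_right)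
  qed
  \<comment> \<open>The increment of \<open>W\<close> is written through increments of
    \<open>Y\<close> and \<Phi> alone, so both its absolute continuity and its derivative follow
    without differentiating the inverse.\<close>
  have W_diff: "W v - W u = D v ** ((Y v - Y u) - (\<Phi> v - \<Phi> u) ** W u)" if "u \<in> {a..b}" "v \<in> {a..b}" for u v
  proof -
    have "D v ** (\<Phi> v ** W u) = W u" "D v ** (\<Phi> u ** W u) = D v ** Y u"
      by (simp_all add: matrix_mul_assoc W_def D[OF that(1)] D[OF that(2)])
    then show ?thesis by (simp add: matrix_mult_diff_left matrix_mult_diff_right W_def)
  qed
  have contD: "continuous_on {a..b} D"
    unfolding continuous_on_def
  proof
    fix u assume u: "u \<in> {a..b}"
    have "((\<lambda>v. M * (norm (\<Phi> u - \<Phi> v) * M)) \<longlongrightarrow> M * (norm (\<Phi> u - \<Phi> u) * M)) (at u within {a..b})"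
      using cont\<Phi> u by (intro tendsto_intros) (auto simp: continuous_on_def)
    then have "((\<lambda>v. M * (norm (\<Phi> u - \<Phi> v) * M)) \<longlongrightarrow> 0) (at u within {a..b})" by simp
    moreover have "norm (D v - D u) \<le> M * (norm (\<Phi> u - \<Phi> v) * M)" if v: "v \<in> {a..b}" for v
    proof -
      have "norm (D v - D u) \<le> norm (D v) * (norm (\<Phi> u - \<Phi> v) * norm (D u))"
        unfolding D_diff[OF u v]
        by (intro order_trans[OF norm_matrix_mult_le] mult_left_mono norm_matrix_mult_le norm_ge_zero)
      also have "\<dots> \<le> M * (norm (\<Phi> u - \<Phi> v) * M)"
        using bound[OF u] bound[OF v] \<open>0 \<le> M\<close> by (intro mult_mono) (auto simp: D_def)
      finally show ?thesis .
    qed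
    then have "\<forall>\<^sub>F v in at u within {a..b}. norm (D v - D u) \<le> M * (norm (\<Phi> u - \<Phi> v) * M)"
      by (auto simp: eventually_at_filter)
    ultimately have "((\<lambda>v. D v - D u) \<longlongrightarrow> 0) (at u within {a..b})"
      by (rule Lim_null_comparison[rotated])
    then show "(D \<longlongrightarrow> D u) (at u within {a..b})"
      by (simp flip: Lim_null)
  qed
  obtain N where N: "\<And>x. x \<in> {a..b} \<Longrightarrow> norm (Y x) \<le> N" "0 \<le> N"
    using continuous_on_interval_max[OF continuous_on_norm[OF contY] \<open>a \<le> b\<close>] norm_ge_zero by metis
  show "abs_cont_on a b (\<lambda>x. matrix_inv (\<Phi> x) ** Y x)"
    unfolding D_def[symmetric] W_def[symmetric]
  proof (rule abs_cont_on_comparison[where g = Y and h = \<Phi> and c = "M * (1 + M * N)"])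
    fix u v assume uv: "u \<in> {a..b}" "v \<in> {a..b}"
    have "norm (W u) \<le> M * N"
      unfolding W_def using bound[OF uv(1)] N(1)[OF uv(1)] \<open>0 \<le> M\<close>
      by (intro order_trans[OF norm_matrix_mult_le] mult_mono) (auto simp: D_def)
    have "norm (W v - W u) \<le> M * norm ((Y v - Y u) - (\<Phi> v - \<Phi> u) ** W u)"
      unfolding W_diff[OF uv] using bound[OF uv(2)]
      by (intro order_trans[OF norm_matrix_mult_le] mult_right_mono) (auto simp: D_def)
    also have "norm ((Y v - Y u) - (\<Phi> v - \<Phi> u) ** W u) \<le> norm (Y v - Y u) + norm ((\<Phi> v - \<Phi> u) ** W u)"
      by (rule norm_triangle_ineq4)
    also have "norm ((\<Phi> v - \<Phi> u) ** W u) \<le> norm (\<Phi> v - \<Phi> u) * (M * N)"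
      using \<open>norm (W u) \<le> M * N\<close> by (intro order_trans[OF norm_matrix_mult_le] mult_left_mono) auto
    finally have "norm (W v - W u) \<le> M * (norm (Y v - Y u) + norm (\<Phi> v - \<Phi> u) * (M * N))"
      using \<open>0 \<le> M\<close> by (simp add: mult_left_mono)
    also have "\<dots> \<le> M * (1 + M * N) * (norm (Y v - Y u) + norm (\<Phi> v - \<Phi> u))"
      using \<open>0 \<le> M\<close> \<open>0 \<le> N\<close> by (simp add: algebra_simps)
    finally show "norm (W v - W u) \<le> M * (1 + M * N) * (norm (Y v - Y u) + norm (\<Phi> v - \<Phi> u))" .
  qed (use Y \<Phi> in \<open>auto simp: solves_on_def\<close>)
  have "AE x in lebesgue. x \<in> {a..b} \<longrightarrow> (Y has_vector_derivative (A x + R x) ** Y x) (at x within {a..b})"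
    "AE x in lebesgue. x \<in> {a..b} \<longrightarrow> (\<Phi> has_vector_derivative A x ** \<Phi> x) (at x within {a..b})"
    using Y \<Phi> by (auto simp: solves_on_def)
  then show "AE x in lebesgue. x \<in> {a..b} \<longrightarrow> ((\<lambda>x. matrix_inv (\<Phi> x) ** Y x) has_vector_derivative
      matrix_inv (\<Phi> x) ** (R x ** Y x)) (at x within {a..b})"
    unfolding D_def[symmetric] W_def[symmetric]
  proof (eventually_elim, intro impI)
    fix u assume u: "u \<in> {a..b}"
      and dY: "u \<in> {a..b} \<longrightarrow> (Y has_vector_derivative (A u + R u) ** Y u) (at u within {a..b})"
      and d\<Phi>: "u \<in> {a..b} \<longrightarrow> (\<Phi> has_vector_derivative A u ** \<Phi> u) (at u within {a..b})"
    have "((\<lambda>v. D v ** ((Y v - Y u) /\<^sub>R (v - u) - ((\<Phi> v - \<Phi> u) /\<^sub>R (v - u)) ** W u)) \<longlongrightarrow>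
        D u ** ((A u + R u) ** Y u - (A u ** \<Phi> u) ** W u)) (at u within {a..b})"
      using dY d\<Phi> u contD
      by (intro tendsto_matrix_mult tendsto_diff tendsto_const)
         (auto simp: has_vector_derivative_iff_quotient continuous_on_def)
    \<comment> \<open>Since \<open>\<Phi> u ** W u = Y u\<close>, the terms with \<open>A\<close>
      cancel.\<close>
    also have "(A u + R u) ** Y u - (A u ** \<Phi> u) ** W u = R u ** Y u"
    proof -
      have "(A u ** \<Phi> u) ** W u = A u ** ((\<Phi> u ** D u) ** Y u)"
        by (simp add: W_def matrix_mul_assoc)
      then show ?thesis by (simp add: D[OF u] matrix_mult_add_left)
    qed
    finally have "((\<lambda>v. D v ** ((Y v - Y u) /\<^sub>R (v - u) - ((\<Phi> v - \<Phi> u) /\<^sub>R (v - u)) ** W u)) \<longlongrightarrow>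
        D u ** (R u ** Y u)) (at u within {a..b})" .
    moreover have "D v ** ((Y v - Y u) /\<^sub>R (v - u) - ((\<Phi> v - \<Phi> u) /\<^sub>R (v - u)) ** W u) = (W v - W u) /\<^sub>R (v - u)"
      if "v \<in> {a..b}" for v
      by (simp add: W_diff[OF u that] matrix_mult_scaleR_left matrix_mult_scaleR_right scaleR_diff_right[symmetric])
    ultimately show "(W has_vector_derivative D u ** (R u ** Y u)) (at u within {a..b})"
      unfolding has_vector_derivative_iff_quotient
      by (rule_tac Lim_transform_eventually) (auto simp: eventually_at_filter)
  qed
qed

section \<open>Bohl and Lyapunov exponents\<close>

text \<open>Some admissible rate lies above \<kappa>; as \<open>x - x'\<close> is nonpositive,
  lowering the rate only weakens the bound. Replacing the constant by its absolute value gives the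
  sign used in later products.\<close>

lemma bohl_lower_bound:
  assumes "ereal \<kappa> < bohl_lower J \<Phi> P"
  obtains C where "C \<ge> 0" "\<And>x x'. x \<in> J \<Longrightarrow> x' \<in> J \<Longrightarrow> x \<le> x' \<Longrightarrow>
    norm (\<Phi> x ** P ** matrix_inv (\<Phi> x')) \<le> C * exp (\<kappa> * (x - x'))"
proof -
  obtain \<kappa>' C where \<kappa>': "\<kappa> < \<kappa>'" and C: "\<And>x x'. x \<in> J \<Longrightarrow> x' \<in> J \<Longrightarrow> x \<le> x' \<Longrightarrow>
      norm (\<Phi> x ** P ** matrix_inv (\<Phi> x')) \<le> C * exp (\<kappa>' * (x - x'))"
    using assms unfolding bohl_lower_def less_Sup_iff by auto
  have "norm (\<Phi> x ** P ** matrix_inv (\<Phi> x')) \<le> \<bar>C\<bar> * exp (\<kappa> * (x - x'))"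
    if "x \<in> J" "x' \<in> J" "x \<le> x'" for x x'
  proof -
    have "C * exp (\<kappa>' * (x - x')) \<le> \<bar>C\<bar> * exp (\<kappa> * (x - x'))"
      using that(3) \<kappa>' by (intro mult_mono) (auto intro: mult_right_mono_neg)
    then show ?thesis using C[OF that] by simp
  qed
  then show ?thesis using that abs_ge_zero by blast
qed

lemma bohl_upper_bound:
  assumes "bohl_upper J \<Phi> P < ereal \<kappa>"
  obtains C where "C \<ge> 0" "\<And>x x'. x \<in> J \<Longrightarrow> x' \<in> J \<Longrightarrow> x \<ge> x' \<Longrightarrow>
    norm (\<Phi> x ** P ** matrix_inv (\<Phi> x')) \<le> C * exp (\<kappa> * (x - x'))"
proof -
  obtain \<kappa>' C where \<kappa>': "\<kappa>' < \<kappa>" and C: "\<And>x x'. x \<in> J \<Longrightarrow> x' \<in> J \<Longrightarrow> x \<ge> x' \<Longrightarrow>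
      norm (\<Phi> x ** P ** matrix_inv (\<Phi> x')) \<le> C * exp (\<kappa>' * (x - x'))"
    using assms unfolding bohl_upper_def Inf_less_iff by auto
  have "norm (\<Phi> x ** P ** matrix_inv (\<Phi> x')) \<le> \<bar>C\<bar> * exp (\<kappa> * (x - x'))"
    if "x \<in> J" "x' \<in> J" "x \<ge> x'" for x x'
  proof -
    have "C * exp (\<kappa>' * (x - x')) \<le> \<bar>C\<bar> * exp (\<kappa> * (x - x'))"
      using that(3) \<kappa>' by (intro mult_mono) (auto intro: mult_right_mono)
    then show ?thesis using C[OF that] by simp
  qed
  then show ?thesis using that abs_ge_zero by blast
qed

lemma bohl_lower_antimono: "J \<subseteq> J' \<Longrightarrow> bohl_lower J' \<Phi> P \<le> bohl_lower J \<Phi> P"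
  unfolding bohl_lower_def by (intro Sup_subset_mono image_mono) blast

lemma bohl_upper_mono: "J \<subseteq> J' \<Longrightarrow> bohl_upper J \<Phi> P \<le> bohl_upper J' \<Phi> P"
  unfolding bohl_upper_def by (intro Inf_superset_mono image_mono) blast

text \<open>Every rate is admissible for the zero matrix, so its exponents are in the wrong order.
  This later shows that \<open>Q1\<close> and \<open>Q2\<close> are nonzero.\<close>

lemma bohl_upper_zero_less: "bohl_upper J \<Phi> 0 < bohl_lower J \<Phi> 0"
proof -
  have "bohl_upper J \<Phi> 0 \<le> ereal (-1)"
    unfolding bohl_upper_def
    by (intro Inf_lower imageI) (auto simp: matrix_mult_zero_left matrix_mult_zero_right intro!: exI[of _ 0])
  also have "\<dots> < ereal 0" by simp
  also have "\<dots> \<le> bohl_lower J \<Phi> 0"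
    unfolding bohl_lower_def
    by (intro Sup_upper imageI) (auto simp: matrix_mult_zero_left matrix_mult_zero_right intro!: exI[of _ 0])
  finally show ?thesis .
qed

section \<open>Comparison of Bohl and Lyapunov exponents on the half line\<close>

lemma exp_decay_tendsto:
  fixes c :: real
  assumes "c < 0"
  shows "((\<lambda>x. B * exp (c * x)) \<longlongrightarrow> 0) at_top"
proof -
  have "filterlim (\<lambda>x. c * x) at_bot at_top"
    by (rule filterlim_tendsto_neg_mult_at_bot[OF tendsto_const assms filterlim_ident])
  then have "((\<lambda>x. exp (c * x)) \<longlongrightarrow> 0) at_top"
    by (rule filterlim_compose[OF exp_at_bot])
  then show ?thesis by (rule tendsto_mult_right_zero)
qed

lemma exp_backward_le:
  fixes \<kappa> :: real
  assumes "0 \<le> C" "0 \<le> s" "s \<le> t"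
  shows "C * exp (\<kappa> * (0 - s)) \<le> C * exp (\<bar>\<kappa>\<bar> * t)"
proof -
  have "\<kappa> * (0 - s) \<le> \<bar>\<kappa>\<bar> * s" using mult_right_mono[of "- \<kappa>" "\<bar>\<kappa>\<bar>" s] assms by simp
  also have "\<dots> \<le> \<bar>\<kappa>\<bar> * t" using assms by (intro mult_left_mono) auto
  finally show ?thesis using assms(1) by (intro mult_left_mono) auto
qed

text \<open>The conjugated projection at \<open>x\<close> is a nonzero idempotent, so its norm is at
  least 1. If the exponents were in reverse order, factoring it through the point 0 would make it
  decay exponentially.\<close>

lemma bohl_lower_le_upper:
  assumes inv: "\<And>x. 0 \<le> x \<Longrightarrow> invertible (\<Phi> x)" and P: "projection P" "P \<noteq> 0"
  shows "bohl_lower {0..} \<Phi> P \<le> bohl_upper {0..} \<Phi> P"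
proof (rule ccontr)
  assume "\<not> ?thesis"
  then have "bohl_upper {0..} \<Phi> P < bohl_lower {0..} \<Phi> P" by simp
  then obtain \<kappa> where \<kappa>: "bohl_upper {0..} \<Phi> P < ereal \<kappa>" "ereal \<kappa> < bohl_lower {0..} \<Phi> P"
    using ereal_dense2 by blast
  then obtain \<kappa>' where \<kappa>': "\<kappa> < \<kappa>'" "ereal \<kappa>' < bohl_lower {0..} \<Phi> P"
    using ereal_dense2 by (metis less_ereal.simps(1))
  obtain C where C: "C \<ge> 0" "\<And>x x'. x \<in> {0..} \<Longrightarrow> x' \<in> {0..} \<Longrightarrow> x \<ge> x' \<Longrightarrow>
      norm (\<Phi> x ** P ** matrix_inv (\<Phi> x')) \<le> C * exp (\<kappa> * (x - x'))"
    using bohl_upper_bound[OF \<kappa>(1)] by blast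
  obtain C' where C': "C' \<ge> 0" "\<And>x x'. x \<in> {0..} \<Longrightarrow> x' \<in> {0..} \<Longrightarrow> x \<le> x' \<Longrightarrow>
      norm (\<Phi> x ** P ** matrix_inv (\<Phi> x')) \<le> C' * exp (\<kappa>' * (x - x'))"
    using bohl_lower_bound[OF \<kappa>'(2)] by blast
  have "1 \<le> C * C' * exp ((\<kappa> - \<kappa>') * x)" if "0 \<le> x" for x
  proof -
    define T where "T = \<Phi> x ** P ** matrix_inv (\<Phi> x)"
    have inv0: "matrix_inv (\<Phi> y) ** (\<Phi> y ** M) = M" if "0 \<le> y" for y M
      by (simp add: matrix_mul_assoc matrix_inv_cancel[OF inv[OF that]])
    have PP: "P ** (P ** M) = P ** M" for M
      using P(1) by (simp add: projection_def matrix_mul_assoc)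
    have T_eq: "T = (\<Phi> x ** P ** matrix_inv (\<Phi> y)) ** (\<Phi> y ** P ** matrix_inv (\<Phi> x))" if "0 \<le> y" for y
      by (simp add: T_def inv0[OF that] PP flip: matrix_mul_assoc)
    have "T \<noteq> 0"
    proof
      assume "T = 0"
      then have "matrix_inv (\<Phi> x) ** (T ** \<Phi> x) = 0"
        by (simp add: matrix_mult_zero_left matrix_mult_zero_right)
      moreover have "matrix_inv (\<Phi> x) ** (T ** \<Phi> x) = P"
        using matrix_inv_cancel[OF inv[OF \<open>0 \<le> x\<close>]]
        by (simp add: T_def inv0[OF \<open>0 \<le> x\<close>] flip: matrix_mul_assoc)
      ultimately show False using P(2) by simp
    qed
    moreover have "norm T \<le> norm T * norm T"
      using norm_matrix_mult_le[of T T] T_eq[OF \<open>0 \<le> x\<close>] by (simp add: T_def)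
    ultimately have "1 \<le> norm T" by simp
    also have "\<dots> \<le> (C * exp (\<kappa> * (x - 0))) * (C' * exp (\<kappa>' * (0 - x)))"
      unfolding T_eq[OF order_refl]
      by (intro order_trans[OF norm_matrix_mult_le] mult_mono C C') (use that C in auto)
    also have "\<dots> = C * C' * exp ((\<kappa> - \<kappa>') * x)"
      by (simp add: algebra_simps exp_diff exp_minus divide_inverse)
    finally show ?thesis .
  qed
  then have "\<forall>\<^sub>F x in at_top. 1 \<le> C * C' * exp ((\<kappa> - \<kappa>') * x)"
    using eventually_ge_at_top by (rule eventually_mono[rotated])
  with exp_decay_tendsto[of "\<kappa> - \<kappa>'" "C * C'"] have "1 \<le> (0::real)"
    using \<kappa>'(1) by (intro tendsto_lowerbound) auto
  then show False by simp
qed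

lemma lyap_plus_less_bound:
  assumes "lyap_plus Z < ereal c"
  shows "\<forall>\<^sub>F x in at_top. norm (Z x) \<le> exp (c * x)"
proof -
  have "\<forall>\<^sub>F x in at_top. ereal (inverse x) * elog (norm (Z x)) < ereal c"
    using assms unfolding lyap_plus_def by (rule Limsup_lessD)
  then show ?thesis using eventually_gt_at_top[of 0]
  proof eventually_elim
    case (elim x)
    show ?case
    proof (cases "Z x = 0")
      case False
      then have "inverse x * ln (norm (Z x)) < c" using elim by (simp add: elog_def)
      then have "ln (norm (Z x)) < c * x" using elim(2) by (simp add: field_simps)
      then show ?thesis using False by (metis exp_ln exp_less_mono less_imp_le zero_less_norm_iff)
    qed simp
  qed
qed

text \<open>The common term \<open>F\<close> cancels, and a single \<mu> fits strictly between both
  exponents and \<open>l\<close>.\<close>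

lemma lyap_plus_diff_bound:
  assumes "lyap_plus (\<lambda>x. Y x - F x) < l" "lyap_plus (\<lambda>x. Y' x - F x) < l"
  obtains \<mu> where "ereal \<mu> < l" "\<forall>\<^sub>F x in at_top. norm (Y x - Y' x) \<le> 2 * exp (\<mu> * x)"
proof -
  obtain \<mu> where \<mu>: "max (lyap_plus (\<lambda>x. Y x - F x)) (lyap_plus (\<lambda>x. Y' x - F x)) < ereal \<mu>" "ereal \<mu> < l"
    using ereal_dense2[of "max (lyap_plus (\<lambda>x. Y x - F x)) (lyap_plus (\<lambda>x. Y' x - F x))" l] assms
    by (auto simp del: less_ereal.simps)
  have "\<forall>\<^sub>F x in at_top. norm (Y x - F x) \<le> exp (\<mu> * x)" "\<forall>\<^sub>F x in at_top. norm (Y' x - F x) \<le> exp (\<mu> * x)"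
    using \<mu>(1) by (auto intro!: lyap_plus_less_bound)
  then have "\<forall>\<^sub>F x in at_top. norm (Y x - Y' x) \<le> 2 * exp (\<mu> * x)"
  proof eventually_elim
    case (elim x)
    then show ?case using norm_triangle_ineq4[of "Y x - F x" "Y' x - F x"] by simp
  qed
  then show ?thesis using that \<mu>(2) by blast
qed

text \<open>Transporting the \<open>P\<close> component from \<open>x\<close> back to 0 gains a
  factor of order \<open>exp (- \<kappa> * x)\<close> with \<kappa> > \<mu>, which beats the assumed
  growth as \<open>x\<close> tends to infinity.\<close>

lemma slow_component_vanishes:
  assumes inv: "\<And>x. 0 \<le> x \<Longrightarrow> invertible (\<Phi> x)" and \<mu>: "ereal \<mu> < bohl_lower {0..} \<Phi> P"
    and growth: "\<forall>\<^sub>F x in at_top. norm (\<Phi> x ** V) \<le> B * exp (\<mu> * x)"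
  shows "P ** V = 0"
proof -
  obtain \<kappa> where \<kappa>: "\<mu> < \<kappa>" "ereal \<kappa> < bohl_lower {0..} \<Phi> P"
    using ereal_dense2[OF \<mu>] by auto
  obtain C where C: "C \<ge> 0" "\<And>x x'. x \<in> {0..} \<Longrightarrow> x' \<in> {0..} \<Longrightarrow> x \<le> x' \<Longrightarrow>
      norm (\<Phi> x ** P ** matrix_inv (\<Phi> x')) \<le> C * exp (\<kappa> * (x - x'))"
    using bohl_lower_bound[OF \<kappa>(2)] by blast
  have "\<forall>\<^sub>F x in at_top. norm (\<Phi> 0 ** (P ** V)) \<le> C * B * exp ((\<mu> - \<kappa>) * x)"
    using growth eventually_ge_at_top[of 0]
  proof eventually_elim
    case (elim x)
    have "\<Phi> 0 ** (P ** V) = (\<Phi> 0 ** P ** matrix_inv (\<Phi> x)) ** (\<Phi> x ** V)"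
      using matrix_inv_cancel(2)[OF inv[OF elim(2)]]
      by (metis matrix_mul_assoc matrix_mul_lid)
    also have "norm \<dots> \<le> (C * exp (\<kappa> * (0 - x))) * (B * exp (\<mu> * x))"
      by (intro order_trans[OF norm_matrix_mult_le] mult_mono C elim(1)) (use elim C in auto)
    also have "\<dots> = C * B * exp ((\<mu> - \<kappa>) * x)"
      by (simp add: algebra_simps exp_diff exp_minus divide_inverse)
    finally show ?case .
  qed
  with exp_decay_tendsto[of "\<mu> - \<kappa>" "C * B"] have "norm (\<Phi> 0 ** (P ** V)) \<le> 0"
    using \<kappa>(1) by (intro tendsto_lowerbound) auto
  then have "matrix_inv (\<Phi> 0) ** (\<Phi> 0 ** (P ** V)) = 0"
    by (simp add: matrix_mult_zero_right)
  then show ?thesis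
    using matrix_inv_cancel(2)[OF inv[OF order_refl]] by (simp add: matrix_mul_assoc)
qed

text \<open>Otherwise the columns of \<open>\<Phi> x ** P\<close> would grow too slowly, and the
  preceding lemma with \<open>V = P\<close> would give \<open>P = 0\<close>.\<close>

lemma bohl_lower_le_lambda_plus:
  assumes inv: "\<And>x. 0 \<le> x \<Longrightarrow> invertible (\<Phi> x)" and P: "projection P" "P \<noteq> 0"
  shows "bohl_lower {0..} \<Phi> P \<le> lambda_plus \<Phi> P"
proof (rule ccontr)
  assume "\<not> ?thesis"
  then obtain \<mu> where \<mu>: "lambda_plus \<Phi> P < ereal \<mu>" "ereal \<mu> < bohl_lower {0..} \<Phi> P"
    using ereal_dense2 by (metis not_le)
  have "\<forall>\<^sub>F x in at_top. norm (\<Phi> x ** P) \<le> 1 * exp (\<mu> * x)"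
    using lyap_plus_less_bound[OF \<mu>(1)[unfolded lambda_plus_def]] by simp
  from slow_component_vanishes[OF inv \<mu>(2) this] show False
    using P by (simp add: projection_def)
qed

text \<open>The three matrices sum to the identity, so their backward bounds add up to one for the
  whole propagator.\<close>

lemma propagator_backward_bound:
  assumes "ereal \<kappa> < bohl_lower J \<Phi> P1" "ereal \<kappa> < bohl_lower J \<Phi> P2"
    "ereal \<kappa> < bohl_lower J \<Phi> (mat 1 - (P1 + P2))"
  obtains C where "C \<ge> 0" "\<And>x x'. x \<in> J \<Longrightarrow> x' \<in> J \<Longrightarrow> x \<le> x' \<Longrightarrow>
    norm (\<Phi> x ** matrix_inv (\<Phi> x')) \<le> C * exp (\<kappa> * (x - x'))"
proof -
  let ?P3 = "mat 1 - (P1 + P2)"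
  obtain C1 where C1: "C1 \<ge> 0" "\<And>x x'. x \<in> J \<Longrightarrow> x' \<in> J \<Longrightarrow> x \<le> x' \<Longrightarrow>
      norm (\<Phi> x ** P1 ** matrix_inv (\<Phi> x')) \<le> C1 * exp (\<kappa> * (x - x'))"
    using bohl_lower_bound[OF assms(1)] by blast
  obtain C2 where C2: "C2 \<ge> 0" "\<And>x x'. x \<in> J \<Longrightarrow> x' \<in> J \<Longrightarrow> x \<le> x' \<Longrightarrow>
      norm (\<Phi> x ** P2 ** matrix_inv (\<Phi> x')) \<le> C2 * exp (\<kappa> * (x - x'))"
    using bohl_lower_bound[OF assms(2)] by blast
  obtain C3 where C3: "C3 \<ge> 0" "\<And>x x'. x \<in> J \<Longrightarrow> x' \<in> J \<Longrightarrow> x \<le> x' \<Longrightarrow>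
      norm (\<Phi> x ** ?P3 ** matrix_inv (\<Phi> x')) \<le> C3 * exp (\<kappa> * (x - x'))"
    using bohl_lower_bound[OF assms(3)] by blast
  show ?thesis
  proof (rule that[of "C1 + C2 + C3"])
    fix x x' assume xx': "x \<in> J" "x' \<in> J" "x \<le> x'"
    have "\<Phi> x = \<Phi> x ** P1 + \<Phi> x ** P2 + \<Phi> x ** ?P3"
      by (simp add: matrix_mult_add_right matrix_mult_diff_right)
    then have "\<Phi> x ** matrix_inv (\<Phi> x') = \<Phi> x ** P1 ** matrix_inv (\<Phi> x')
        + \<Phi> x ** P2 ** matrix_inv (\<Phi> x') + \<Phi> x ** ?P3 ** matrix_inv (\<Phi> x')"
      by (metis matrix_mult_add_left)
    also have "norm \<dots> \<le> C1 * exp (\<kappa> * (x - x')) + C2 * exp (\<kappa> * (x - x')) + C3 * exp (\<kappa> * (x - x'))"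
      by (intro order_trans[OF norm_triangle_ineq] add_mono C1 C2 C3 xx')
    finally show "norm (\<Phi> x ** matrix_inv (\<Phi> x')) \<le> (C1 + C2 + C3) * exp (\<kappa> * (x - x'))"
      by (simp add: distrib_right)
  qed (use C1 C2 C3 in auto)
qed

section \<open>Perturbed solutions of small growth\<close>

text \<open>The integral is monotone and bounded in its upper limit; once it is within \<epsilon> of
  its supremum, at most \<epsilon> remains. The start \<open>x0\<close> may be pushed beyond any
  given \<open>X\<close>.\<close>

lemma integral_tail_small:
  fixes f :: "real \<Rightarrow> real"
  assumes int: "\<And>t. f integrable_on {0..t}" and nonneg: "\<And>x. f x \<ge> 0"
    and bdd: "\<And>t. 0 \<le> t \<Longrightarrow> integral {0..t} f \<le> I" and "\<epsilon> > 0"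
  obtains x0 where "x0 \<ge> X" "x0 \<ge> 0" "\<And>x. x \<ge> x0 \<Longrightarrow> integral {x0..x} f \<le> \<epsilon>"
proof -
  let ?F = "\<lambda>t. integral {0..t} f"
  have bddF: "bdd_above (?F ` {0..})" using bdd by (auto intro!: bdd_aboveI)
  have "Sup (?F ` {0..}) - \<epsilon> < Sup (?F ` {0..})" using \<open>\<epsilon> > 0\<close> by simp
  then obtain t where t: "t \<ge> 0" "Sup (?F ` {0..}) - \<epsilon> < ?F t"
    using less_cSup_iff[OF _ bddF] by (auto simp: image_iff)
  define x0 where "x0 = max t X"
  have x0: "x0 \<ge> t" "x0 \<ge> X" "x0 \<ge> 0" using t(1) by (auto simp: x0_def)
  show ?thesis
  proof (rule that[OF x0(2,3)])
    fix x assume "x \<ge> x0"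
    have "?F x0 + integral {x0..x} f = ?F x"
      using x0 \<open>x \<ge> x0\<close> int by (intro Henstock_Kurzweil_Integration.integral_combine) auto
    moreover have "?F x \<le> Sup (?F ` {0..})"
      using x0 \<open>x \<ge> x0\<close> by (intro cSUP_upper bddF) auto
    moreover have "?F t \<le> ?F x0"
      using x0 nonneg by (intro integral_subset_le int) auto
    ultimately show "integral {x0..x} f \<le> \<epsilon>" using t(2) by linarith
  qed
qed

text \<open>
  Variation of constants from infinity: on a tail where \<open>R\<close> has small integral, the weighted supremum
  of \<open>U\<close> is at most half of itself.
\<close>

lemma fast_decaying_solution_zero:
  assumes \<Phi>: "fundamental_on {0..} A \<Phi>" and A: "loc_L1 A" and R: "loc_L1 R"
    and bdd: "\<And>t. 0 \<le> t \<Longrightarrow> integral {0..t} (\<lambda>x. norm (R x)) \<le> I"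
    and C: "C \<ge> 0" "\<And>x x'. x \<in> {0..} \<Longrightarrow> x' \<in> {0..} \<Longrightarrow> x \<le> x' \<Longrightarrow>
      norm (\<Phi> x ** matrix_inv (\<Phi> x')) \<le> C * exp (\<kappa> * (x - x'))"
    and U: "solves_on {0..} (\<lambda>x. A x + R x) U"
    and growth: "\<forall>\<^sub>F x in at_top. norm (U x) \<le> B * exp (\<mu> * x)" and "\<mu> < \<kappa>" and "x \<ge> 0"
  shows "U x = 0"
proof -
  define z where "z x = exp (- \<kappa> * x) * norm (U x)" for x
  have inv: "invertible (\<Phi> x)" if "0 \<le> x" for x
    using fundamental_on_invertible[OF \<Phi> A that] .
  have \<Phi>0: "\<Phi> 0 = mat 1" "solves_on {0..} A \<Phi>" using \<Phi> by (auto simp: fundamental_on_def)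
  obtain X where X: "\<And>x. x \<ge> X \<Longrightarrow> norm (U x) \<le> B * exp (\<mu> * x)"
    using growth unfolding eventually_at_top_linorder by blast
  \<comment> \<open>Chosen so that \<open>C * \<epsilon>\<close> is at most 1/2, including the case
    \<open>C = 0\<close>.\<close>
  define \<epsilon> where "\<epsilon> = 1 / (2 * (C + 1))"
  have \<epsilon>: "\<epsilon> > 0" "C * \<epsilon> \<le> 1/2" using C(1) by (auto simp: \<epsilon>_def field_simps)
  obtain x0 where x0: "x0 \<ge> X" "x0 \<ge> 0" "\<And>x. x \<ge> x0 \<Longrightarrow> integral {x0..x} (\<lambda>x. norm (R x)) \<le> \<epsilon>"
    using integral_tail_small[OF loc_L1_norm_integrable[OF R] norm_ge_zero bdd \<epsilon>(1)] by blast
  have z_le: "z x \<le> B * exp ((\<mu> - \<kappa>) * x)" if "x \<ge> x0" for x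
  proof -
    have "z x \<le> exp (- \<kappa> * x) * (B * exp (\<mu> * x))"
      unfolding z_def using X that x0(1) by (intro mult_left_mono) auto
    also have "\<dots> = B * exp ((\<mu> - \<kappa>) * x)"
      by (simp add: algebra_simps exp_diff exp_minus divide_inverse)
    finally show ?thesis .
  qed
  have z_nonneg: "z x \<ge> 0" for x by (simp add: z_def)
  have bddz: "bdd_above (z ` {x0..})"
  proof (rule bdd_aboveI2)
    fix x assume x: "x \<in> {x0..}"
    \<comment> \<open>No sign of \<open>B\<close> is assumed; it follows from \<open>z\<close> being
      nonnegative.\<close>
    have "0 \<le> B * exp ((\<mu> - \<kappa>) * x)" using z_le[of x] z_nonneg[of x] x by auto
    then have "B \<ge> 0" by (simp add: zero_le_mult_iff)
    then have "B * exp ((\<mu> - \<kappa>) * x) \<le> B * 1"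
      using x x0(2) \<open>\<mu> < \<kappa>\<close> by (intro mult_left_mono) (auto simp: mult_le_0_iff)
    then show "z x \<le> B" using z_le[of x] x by simp
  qed
  define M where "M = Sup (z ` {x0..})"
  have z_M: "z x \<le> M" if "x \<ge> x0" for x
    unfolding M_def using that bddz by (intro cSUP_upper) auto
  have "M \<ge> 0" using order_trans[OF z_nonneg z_M] by blast
  \<comment> \<open>Variation of constants on a finite interval: the boundary term at
    \<open>x'\<close> is kept, and the integral term costs at most half of the weighted supremum
    \<open>M\<close>.\<close>
  have main: "z x \<le> C * z x' + M / 2" if xx': "x0 \<le> x" "x \<le> x'" for x x'
  proof -
    let ?D = "\<lambda>s. matrix_inv (\<Phi> s)"
    have sub: "{x..x'} \<subseteq> {0..}" using xx' x0 by auto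
    have "((\<lambda>s. ?D s ** (R s ** U s)) has_integral (?D x' ** U x' - ?D x ** U x)) {x..x'}"
    proof (rule variation_of_constants[OF solves_on_subset[OF \<Phi>0(2) sub] _ _ solves_on_subset[OF U sub] xx'(2)])
      fix s assume s: "s \<in> {x..x'}"
      show "invertible (\<Phi> s)" using inv s sub by auto
      have "norm (?D s) \<le> C * exp (\<kappa> * (0 - s))"
        using C(2)[of 0 s] s sub by (auto simp: \<Phi>0(1))
      also have "\<dots> \<le> C * exp (\<bar>\<kappa>\<bar> * x')"
        using C(1) s sub by (intro exp_backward_le) auto
      finally show "norm (?D s) \<le> C * exp (\<bar>\<kappa>\<bar> * x')" .
    qed
    then have hi: "((\<lambda>s. \<Phi> x ** (?D s ** (R s ** U s))) has_integral
        (\<Phi> x ** (?D x' ** U x' - ?D x ** U x))) {x..x'}"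
      using has_integral_linear[OF _ bounded_bilinear.bounded_linear_right[OF bounded_bilinear_matrix_mult]]
      by (simp add: o_def)
    have "\<Phi> x ** (?D x ** U x) = U x"
      using matrix_inv_cancel(1)[OF inv] xx' x0 by (simp add: matrix_mul_assoc)
    then have U_eq: "U x = \<Phi> x ** ?D x' ** U x' - integral {x..x'} (\<lambda>s. \<Phi> x ** (?D s ** (R s ** U s)))"
      using integral_unique[OF hi] by (simp add: matrix_mult_diff_right matrix_mul_assoc)
    have "norm (integral {x..x'} (\<lambda>s. \<Phi> x ** (?D s ** (R s ** U s))))
        \<le> integral {x..x'} (\<lambda>s. C * M * exp (\<kappa> * x) * norm (R s))"
    proof (rule integral_norm_bound_integral)
      show "(\<lambda>s. \<Phi> x ** (?D s ** (R s ** U s))) integrable_on {x..x'}" using hi by blast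
      show "(\<lambda>s. C * M * exp (\<kappa> * x) * norm (R s)) integrable_on {x..x'}"
        by (intro integrable_on_mult_right loc_L1_norm_integrable R)
      fix s assume s: "s \<in> {x..x'}"
      have "norm (U s) = exp (\<kappa> * s) * z s" by (simp add: z_def exp_minus)
      also have "\<dots> \<le> exp (\<kappa> * s) * M" using s xx' by (intro mult_left_mono z_M) auto
      finally have Us: "norm (U s) \<le> exp (\<kappa> * s) * M" .
      have "norm (\<Phi> x ** (?D s ** (R s ** U s))) = norm ((\<Phi> x ** ?D s) ** (R s ** U s))"
        by (simp add: matrix_mul_assoc)
      also have "\<dots> \<le> (C * exp (\<kappa> * (x - s))) * (norm (R s) * (exp (\<kappa> * s) * M))"
        by (intro order_trans[OF norm_matrix_mult_le] mult_mono C Us order_refl)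
           (use s xx' x0 C(1) in auto)
      \<comment> \<open>The weight of \<open>U s\<close> cancels the dependence of the propagator
        bound on \<open>s\<close>, leaving only \<open>norm (R s)\<close> to integrate.\<close>
      also have "\<dots> = C * M * exp (\<kappa> * x) * norm (R s)"
        by (simp add: right_diff_distrib exp_diff)
      finally show "norm (\<Phi> x ** (?D s ** (R s ** U s))) \<le> C * M * exp (\<kappa> * x) * norm (R s)" .
    qed
    also have "\<dots> = C * M * exp (\<kappa> * x) * integral {x..x'} (\<lambda>s. norm (R s))"
      by (rule integral_mult_right)
    also have "\<dots> \<le> C * M * exp (\<kappa> * x) * \<epsilon>"
    proof (rule mult_left_mono)
      have "integral {x..x'} (\<lambda>s. norm (R s)) \<le> integral {x0..x'} (\<lambda>s. norm (R s))"
        using xx' by (intro integral_subset_le loc_L1_norm_integrable R) auto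
      then show "integral {x..x'} (\<lambda>s. norm (R s)) \<le> \<epsilon>" using x0(3)[of x'] xx' by auto
    qed (use C(1) \<open>M \<ge> 0\<close> in auto)
    also have "\<dots> = (C * \<epsilon>) * (M * exp (\<kappa> * x))" by simp
    also have "\<dots> \<le> (1/2) * (M * exp (\<kappa> * x))"
      using \<epsilon>(2) \<open>M \<ge> 0\<close> by (intro mult_right_mono) auto
    finally have int_le: "norm (integral {x..x'} (\<lambda>s. \<Phi> x ** (?D s ** (R s ** U s)))) \<le> (1/2) * (M * exp (\<kappa> * x))" .
    have "norm (U x) \<le> norm (\<Phi> x ** ?D x' ** U x') + (1/2) * (M * exp (\<kappa> * x))"
      unfolding U_eq by (intro order_trans[OF norm_triangle_ineq4] add_mono order_refl int_le)
    also have "norm (\<Phi> x ** ?D x' ** U x') \<le> C * exp (\<kappa> * (x - x')) * norm (U x')"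
      by (intro order_trans[OF norm_matrix_mult_le] mult_right_mono C(2)) (use xx' x0 in auto)
    finally have "norm (U x) \<le> C * exp (\<kappa> * (x - x')) * norm (U x') + (1/2) * (M * exp (\<kappa> * x))" by simp
    then have "z x \<le> exp (- \<kappa> * x) * (C * exp (\<kappa> * (x - x')) * norm (U x') + (1/2) * (M * exp (\<kappa> * x)))"
      unfolding z_def by (intro mult_left_mono) auto
    also have "\<dots> = C * ((exp (- \<kappa> * x) * exp (\<kappa> * (x - x'))) * norm (U x'))
        + (exp (- \<kappa> * x) * exp (\<kappa> * x)) * (M / 2)"
      by (simp only: distrib_left mult_ac times_divide_eq_left times_divide_eq_right mult_1)
    also have "exp (- \<kappa> * x) * exp (\<kappa> * (x - x')) = exp (- \<kappa> * x')"
      by (simp add: mult_exp_exp right_diff_distrib)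
    also have "exp (- \<kappa> * x) * exp (\<kappa> * x) = 1"
      by (simp add: mult_exp_exp)
    also have "C * (exp (- \<kappa> * x') * norm (U x')) + 1 * (M / 2) = C * z x' + M / 2"
      by (simp add: z_def)
    finally show ?thesis .
  qed
  have half: "z x \<le> M / 2" if "x \<ge> x0" for x
  proof -
    \<comment> \<open>Letting \<open>x'\<close> tend to infinity removes the boundary term because
      \<mu> < \<kappa>.\<close>
    have "\<forall>\<^sub>F x' in at_top. z x - M / 2 \<le> C * B * exp ((\<mu> - \<kappa>) * x')"
      using eventually_ge_at_top[of x]
    proof eventually_elim
      case (elim x')
      have "z x \<le> C * z x' + M / 2" by (rule main[OF that elim])
      also have "C * z x' \<le> C * (B * exp ((\<mu> - \<kappa>) * x'))"
        using C(1) z_le[of x'] that elim by (intro mult_left_mono) auto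
      finally show ?case by simp
    qed
    with exp_decay_tendsto[of "\<mu> - \<kappa>" "C * B"] have "z x - M / 2 \<le> 0"
      using \<open>\<mu> < \<kappa>\<close> by (intro tendsto_lowerbound) auto
    then show ?thesis by simp
  qed
  \<comment> \<open>The supremum is finite and nonnegative, so this forces \<open>M = 0\<close>;
    below \<open>x0\<close> backward uniqueness takes over.\<close>
  have "M \<le> M / 2" unfolding M_def[symmetric] by (subst M_def, rule cSUP_least) (use half in auto)
  then have tail: "U x = 0" if "x \<ge> x0" for x
    using z_M[OF that] z_nonneg[of x] \<open>M \<ge> 0\<close> by (simp add: z_def mult_le_0_iff)
  show ?thesis
  proof (cases "x \<ge> x0")
    case False
    have "solves_on {0..x0} (\<lambda>x. A x + R x) U" by (rule solves_on_subset[OF U]) auto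
    moreover have "x \<in> {0..x0}" using False \<open>x \<ge> 0\<close> by simp
    moreover have "(\<lambda>x. norm (A x + R x)) integrable_on {0..x0}"
      by (rule loc_L1_norm_integrable[OF loc_L1_add[OF A R]])
    ultimately show ?thesis
      using solves_on_backward_unique[where Z = U] tail[OF order_refl] by blast
  qed (rule tail)
qed

text \<open>Variation of constants with zero perturbation shows that the inverse of \<Psi> times
  \<open>U\<close> is constant. The bound on the inverse is the regularity that formula asks
  for.\<close>

lemma solution_eq_fundamental_mult:
  assumes \<Psi>: "fundamental_on {0..} B \<Psi>" and B: "loc_L1 B" and U: "solves_on {0..} B U" and "x \<ge> 0"
    and bound: "\<And>s. s \<in> {0..x} \<Longrightarrow> norm (matrix_inv (\<Psi> s)) \<le> M"
  shows "U x = \<Psi> x ** U 0"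
proof -
  have inv: "invertible (\<Psi> s)" if "0 \<le> s" for s
    using fundamental_on_invertible[OF \<Psi> B that] .
  have sub: "{0..x} \<subseteq> {0..}" by auto
  have \<Psi>0: "\<Psi> 0 = mat 1" "solves_on {0..} B \<Psi>" using \<Psi> by (auto simp: fundamental_on_def)
  have "((\<lambda>s. matrix_inv (\<Psi> s) ** (0 ** U s)) has_integral
      (matrix_inv (\<Psi> x) ** U x - matrix_inv (\<Psi> 0) ** U 0)) {0..x}"
    using solves_on_subset[OF U sub] inv bound
    by (intro variation_of_constants[OF solves_on_subset[OF \<Psi>0(2) sub], of M "\<lambda>_. 0"] \<open>x \<ge> 0\<close>) auto
  then have "matrix_inv (\<Psi> x) ** U x - matrix_inv (\<Psi> 0) ** U 0 = 0"
    by (auto simp: matrix_mult_zero_left matrix_mult_zero_right has_integral_0_eq)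
  moreover have "matrix_inv (\<Psi> 0) = mat 1"
    using matrix_inv_cancel(1)[OF inv[OF order_refl]] by (simp add: \<Psi>0)
  ultimately have "matrix_inv (\<Psi> x) ** U x = U 0" by simp
  then have "\<Psi> x ** U 0 = (\<Psi> x ** matrix_inv (\<Psi> x)) ** U x" by (metis matrix_mul_assoc)
  then show ?thesis using matrix_inv_cancel(1)[OF inv[OF \<open>x \<ge> 0\<close>]] by simp
qed

text \<open>Slow growth kills the \<open>P2\<close> component and the complementary one. For
  \<open>P1\<close> a lower exponent above -\<infinity> suffices: it supplies the local bound on the
  inverse that identifies \<open>U\<close> with \<open>\<Psi> x ** U 0\<close>.\<close>

lemma small_growth_solution_mat_range:
  assumes \<Psi>: "fundamental_on {0..} B \<Psi>" and B: "loc_L1 B" and U: "solves_on {0..} B U"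
    and lower: "bohl_lower {0..} \<Psi> P1 > - \<infinity>" "ereal \<mu> < bohl_lower {0..} \<Psi> P2"
      "ereal \<mu> < bohl_lower {0..} \<Psi> (mat 1 - (P1 + P2))"
    and growth: "\<forall>\<^sub>F x in at_top. norm (U x) \<le> b * exp (\<mu> * x)"
  shows "mat_range (U 0) \<subseteq> mat_range P1"
proof -
  let ?P3 = "mat 1 - (P1 + P2)"
  have inv: "invertible (\<Psi> s)" if "0 \<le> s" for s
    using fundamental_on_invertible[OF \<Psi> B that] .
  have "- \<infinity> < min (bohl_lower {0..} \<Psi> P1) (ereal \<mu>)" using lower(1) by simp
  then obtain \<kappa> where \<kappa>: "ereal \<kappa> < bohl_lower {0..} \<Psi> P1" "\<kappa> < \<mu>"
    using ereal_dense2[of "- \<infinity>"] by (metis less_ereal.simps(1) min_less_iff_conj)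
  have less: "ereal \<kappa> < l" if "ereal \<mu> < l" for l
    using less_trans[of "ereal \<kappa>" "ereal \<mu>" l] \<kappa>(2) that by simp
  obtain C where C: "C \<ge> 0" "\<And>x x'. x \<in> {0..} \<Longrightarrow> x' \<in> {0..} \<Longrightarrow> x \<le> x' \<Longrightarrow>
      norm (\<Psi> x ** matrix_inv (\<Psi> x')) \<le> C * exp (\<kappa> * (x - x'))"
    using propagator_backward_bound[OF \<kappa>(1) less[OF lower(2)] less[OF lower(3)]] by blast
  have eq: "U x = \<Psi> x ** U 0" if "x \<ge> 0" for x
  proof (rule solution_eq_fundamental_mult[OF \<Psi> B U that, of "C * exp (\<bar>\<kappa>\<bar> * x)"])
    fix s assume s: "s \<in> {0..x}"
    have "norm (matrix_inv (\<Psi> s)) \<le> C * exp (\<kappa> * (0 - s))"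
      using C(2)[of 0 s] s \<Psi> by (auto simp: fundamental_on_def)
    also have "\<dots> \<le> C * exp (\<bar>\<kappa>\<bar> * x)"
      using C(1) s by (intro exp_backward_le) auto
    finally show "norm (matrix_inv (\<Psi> s)) \<le> C * exp (\<bar>\<kappa>\<bar> * x)" .
  qed
  have "\<forall>\<^sub>F x in at_top. norm (\<Psi> x ** U 0) \<le> b * exp (\<mu> * x)"
    using growth eventually_ge_at_top[of 0] by eventually_elim (simp flip: eq)
  from slow_component_vanishes[OF inv lower(2) this] slow_component_vanishes[OF inv lower(3) this]
  have "U 0 = P1 ** U 0"
    by (simp add: matrix_mult_diff_left matrix_mult_add_left)
  then have "U 0 *v v = P1 *v (U 0 *v v)" for v
    by (simp add: matrix_vector_mul_assoc)
  then show ?thesis unfolding mat_range_def by auto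
qed

lemma weighted_integral_bound:
  assumes R: "loc_L1 R" and int: "(\<lambda>x. exp (\<beta> * x) * norm (R x)) integrable_on {0..}" and "\<beta> \<ge> 0"
  shows "integral {0..t} (\<lambda>x. norm (R x)) \<le> integral {0..} (\<lambda>x. exp (\<beta> * x) * norm (R x))"
proof -
  have int_t: "(\<lambda>x. exp (\<beta> * x) * norm (R x)) integrable_on {0..t}"
    by (rule integrable_on_subinterval[OF int]) auto
  have "integral {0..t} (\<lambda>x. norm (R x)) \<le> integral {0..t} (\<lambda>x. exp (\<beta> * x) * norm (R x))"
  proof (intro integral_le loc_L1_norm_integrable R int_t)
    fix x assume "x \<in> {0..t}"
    then show "norm (R x) \<le> exp (\<beta> * x) * norm (R x)"
      using \<open>\<beta> \<ge> 0\<close> by (intro mult_le_cancel_right1[THEN iffD2]) auto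
  qed
  also have "\<dots> \<le> integral {0..} (\<lambda>x. exp (\<beta> * x) * norm (R x))"
    by (intro integral_subset_le int_t int) auto
  finally show ?thesis .
qed

section \<open>Uniqueness of the first Jost solution and non-uniqueness range of the second\<close>

theorem corollary6p6:
  fixes A R \<Phi> :: "real \<Rightarrow> complex ^ 'n::finite ^ 'n"
    and Q Q1 Q2 :: "complex ^ 'n ^ 'n"
    and \<beta> :: real
  assumes "loc_L1 A"
    and "fundamental_on UNIV A \<Phi>"
    and "propagator_exp_bounded \<Phi>"
    and "exp_dichotomy \<Phi> Q"
    and "Q = Q1 + Q2"
    and "unif_conjugated UNIV \<Phi> Q1"
    and "unif_conjugated UNIV \<Phi> Q2"
    and "bohl_lower UNIV \<Phi> Q1 \<le> bohl_upper UNIV \<Phi> Q1"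
    and "bohl_upper UNIV \<Phi> Q1 < bohl_lower UNIV \<Phi> Q2"
    and "bohl_lower UNIV \<Phi> Q2 \<le> bohl_upper UNIV \<Phi> Q2"
    and "bohl_upper UNIV \<Phi> Q2 < 0"
    and "0 < bohl_lower UNIV \<Phi> (mat 1 - Q)"
    and "bohl_lower UNIV \<Phi> (mat 1 - Q) \<le> bohl_upper UNIV \<Phi> (mat 1 - Q)"
    and "loc_L1 R"
    and "(\<lambda>x. exp (\<beta> * x) * norm (R x)) absolutely_integrable_on {0..}"
    and "ereal \<beta> > max (lambda_plus \<Phi> Q1 - bohl_lower {0..} \<Phi> Q1)
                          (lambda_plus \<Phi> Q2 - bohl_lower {0..} \<Phi> Q2)"
  shows
    "(\<forall>Y Y'. jost_solution A R \<Phi> Q1 Y \<and> jost_solution A R \<Phi> Q1 Y' \<longrightarrow> (\<forall>x\<ge>0. Y x = Y' x)) \<and>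
     (\<forall>\<Psi> P1 P2 Y Y'.
        fundamental_on {0..} (\<lambda>x. A x + R x) \<Psi> \<and> perturbed_splitting \<Phi> Q1 Q2 \<Psi> P1 P2 \<and>
        jost_solution A R \<Phi> Q2 Y \<and> jost_solution A R \<Phi> Q2 Y'
        \<longrightarrow> mat_range (Y 0 - Y' 0) \<subseteq> mat_range P1)"
proof -
  let ?l = "bohl_lower {0..} \<Phi>" and ?u = "bohl_upper {0..} \<Phi>"
  have \<Phi>: "fundamental_on {0..} A \<Phi>"
    using assms(2) by (auto simp: fundamental_on_def intro: solves_on_subset)
  have inv: "invertible (\<Phi> x)" if "0 \<le> x" for x
    using fundamental_on_invertible[OF \<Phi> assms(1) that] .
  have proj: "projection Q1" "projection Q2"
    using assms(6,7) by (auto simp: unif_conjugated_def)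
  have ne: "Q1 \<noteq> 0" "Q2 \<noteq> 0"
    using assms(8,10) bohl_upper_zero_less[of UNIV \<Phi>] by (auto simp flip: not_le)
  \<comment> \<open>Restriction to the half line can raise a lower exponent, so the gap between the
    segments is carried over through the upper exponent, which can only drop.\<close>
  have "?l Q1 \<le> ?u Q1" by (rule bohl_lower_le_upper[OF inv proj(1) ne(1)])
  also have "\<dots> \<le> bohl_upper UNIV \<Phi> Q1" by (rule bohl_upper_mono) simp
  also have "\<dots> < bohl_lower UNIV \<Phi> Q2" by (rule assms(9))
  also have "\<dots> \<le> ?l Q2" by (rule bohl_lower_antimono) simp
  finally have l12: "?l Q1 < ?l Q2" .
  have "?l Q2 \<le> ?u Q2" by (rule bohl_lower_le_upper[OF inv proj(2) ne(2)])
  also have "\<dots> \<le> bohl_upper UNIV \<Phi> Q2" by (rule bohl_upper_mono) simp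
  also have "\<dots> < 0" by (rule assms(11))
  finally have l2: "?l Q2 < 0" .
  have "0 < bohl_lower UNIV \<Phi> (mat 1 - (Q1 + Q2))" using assms(5,12) by simp
  also have "\<dots> \<le> ?l (mat 1 - (Q1 + Q2))" by (rule bohl_lower_antimono) simp
  finally have l3: "0 < ?l (mat 1 - (Q1 + Q2))" .
  have \<beta>1: "lambda_plus \<Phi> Q1 - ?l Q1 < ereal \<beta>" using assms(16) by simp
  \<comment> \<open>In \<open>ereal\<close>, subtracting -\<infinity> gives \<infinity>, which
    cannot lie below the real \<beta>.\<close>
  have l1: "?l Q1 > - \<infinity>"
    using \<beta>1 by (cases "?l Q1"; cases "lambda_plus \<Phi> Q1") auto
  have "?l Q1 \<le> lambda_plus \<Phi> Q1" by (rule bohl_lower_le_lambda_plus[OF inv proj(1) ne(1)])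
  \<comment> \<open>Here \<open>l1\<close> and \<open>l12\<close> make the lower exponent of
    \<open>Q1\<close> finite, so the difference bounded by \<beta> is a genuine nonnegative
    quantity.\<close>
  with \<beta>1 l1 l12 have "\<beta> \<ge> 0"
    by (cases "?l Q1"; cases "lambda_plus \<Phi> Q1") auto
  have int: "(\<lambda>x. exp (\<beta> * x) * norm (R x)) integrable_on {0..}"
    using assms(15) by (rule set_lebesgue_integral_eq_integral(1))
  show ?thesis
  proof (intro conjI allI impI)
    fix Y Y' and x :: real
    assume "jost_solution A R \<Phi> Q1 Y \<and> jost_solution A R \<Phi> Q1 Y'" and "x \<ge> 0"
    then have sol: "solves_on {0..} (\<lambda>x. A x + R x) Y" "solves_on {0..} (\<lambda>x. A x + R x) Y'"
      and lyap: "lyap_plus (\<lambda>x. Y x - \<Phi> x ** Q1) < ?l Q1" "lyap_plus (\<lambda>x. Y' x - \<Phi> x ** Q1) < ?l Q1"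
      by (auto simp: jost_solution_def)
    obtain \<mu> where \<mu>: "ereal \<mu> < ?l Q1" "\<forall>\<^sub>F x in at_top. norm (Y x - Y' x) \<le> 2 * exp (\<mu> * x)"
      using lyap_plus_diff_bound[OF lyap] by blast
    obtain \<kappa> where \<kappa>: "\<mu> < \<kappa>" "ereal \<kappa> < ?l Q1"
      using ereal_dense2[OF \<mu>(1)] by auto
    have \<kappa>2: "ereal \<kappa> < ?l Q2" using \<kappa>(2) l12 by (rule less_trans)
    have \<kappa>3: "ereal \<kappa> < ?l (mat 1 - (Q1 + Q2))" using \<kappa>2 l2 l3 by (meson less_trans)
    obtain C where C: "C \<ge> 0" "\<And>x x'. x \<in> {0..} \<Longrightarrow> x' \<in> {0..} \<Longrightarrow> x \<le> x' \<Longrightarrow>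
        norm (\<Phi> x ** matrix_inv (\<Phi> x')) \<le> C * exp (\<kappa> * (x - x'))"
      using propagator_backward_bound[OF \<kappa>(2) \<kappa>2 \<kappa>3] by blast
    have "Y x - Y' x = 0"
      by (rule fast_decaying_solution_zero[OF \<Phi> assms(1,14)
            weighted_integral_bound[OF assms(14) int \<open>\<beta> \<ge> 0\<close>] C solves_on_diff[OF sol] \<mu>(2) \<kappa>(1) \<open>x \<ge> 0\<close>])
    then show "Y x = Y' x" by simp
  next
    fix \<Psi> P1 P2 Y Y'
    assume *: "fundamental_on {0..} (\<lambda>x. A x + R x) \<Psi> \<and> perturbed_splitting \<Phi> Q1 Q2 \<Psi> P1 P2 \<and>
        jost_solution A R \<Phi> Q2 Y \<and> jost_solution A R \<Phi> Q2 Y'"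
    then have \<Psi>: "fundamental_on {0..} (\<lambda>x. A x + R x) \<Psi>"
      and sol: "solves_on {0..} (\<lambda>x. A x + R x) Y" "solves_on {0..} (\<lambda>x. A x + R x) Y'"
      and lyap: "lyap_plus (\<lambda>x. Y x - \<Phi> x ** Q2) < ?l Q2" "lyap_plus (\<lambda>x. Y' x - \<Phi> x ** Q2) < ?l Q2"
      by (auto simp: jost_solution_def)
    \<comment> \<open>The splitting transfers the exponents to the perturbed equation: \<mu> will
      lie below that of \<open>P2\<close>, hence below 0 and below that of the complement.\<close>
    from * have P: "bohl_lower {0..} \<Psi> P1 = ?l Q1" "bohl_lower {0..} \<Psi> P2 = ?l Q2"
      "0 < bohl_lower {0..} \<Psi> (mat 1 - (P1 + P2))"
      by (auto simp: perturbed_splitting_def Let_def)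
    obtain \<mu> where \<mu>: "ereal \<mu> < ?l Q2" "\<forall>\<^sub>F x in at_top. norm (Y x - Y' x) \<le> 2 * exp (\<mu> * x)"
      using lyap_plus_diff_bound[OF lyap] by blast
    show "mat_range (Y 0 - Y' 0) \<subseteq> mat_range P1"
    proof (rule small_growth_solution_mat_range[OF \<Psi> loc_L1_add[OF assms(1,14)] solves_on_diff[OF sol] _ _ _ \<mu>(2)])
      show "ereal \<mu> < bohl_lower {0..} \<Psi> (mat 1 - (P1 + P2))"
        using \<mu>(1) l2 P(3) by (meson less_trans)
    qed (use l1 P \<mu>(1) in auto)
  qed
qed

end
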